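(* Let $\Omega\subset\mathbb{R}^N$ be a bounded open set with Lipschitz boundary $\Gamma$, let $a>0$ be a constant, and assume that $b(x)=b$ and $c(x)=c$ are constant in $\Omega$, with $b>0$ and $c\in\mathbb{R}\setminus\{0\}$. Then the energy of the system $$u_{tt}-\operatorname{div}(a\nabla u+b\nabla u_t)+c\,y_t=0,\qquad y_{tt}-\Delta y-c\,u_t=0\quad\text{in }\Omega\times\mathbb{R}^+,$$ with $u=y=0$ on $\Gamma\times\mathbb{R}^+$, does not decay uniformly in the energy space $\mathcal{H}$; that is, there do not exist constants $M,\epsilon>0$ such that $\|e^{t\mathcal{A}}U_0\|_{\mathcal{H}}\le Me^{-\epsilon t}\|U_0\|_{\mathcal{H}}$ for all $t>0$ and all $U_0\in\mathcal{H}$.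
   Context: The energy space is $\mathcal{H}=\left(H_0^1(\Omega)\times L^2(\Omega)\right)^2$ with norm $\|(u,v,y,z)\|_{\mathcal{H}}^2=\int_\Omega\left(a|\nabla u|^2+|v|^2+|\nabla y|^2+|z|^2\right)dx$. The operator $\mathcal{A}$ on $\mathcal{H}$ has domain $$D(\mathcal{A})=\{(u,v,y,z)\in\mathcal{H}:\ v,z\in H_0^1(\Omega),\ \operatorname{div}(a\nabla u+b\nabla v)\in L^2(\Omega),\ y\in H^2(\Omega)\cap H_0^1(\Omega)\}$$ and acts by $\mathcal{A}(u,v,y,z)=\left(v,\ \operatorname{div}(a\nabla u+b\nabla v)-cz,\ z,\ \Delta y+cv\right)$. It generates a $C_0$-semigroup of contractions $(e^{t\mathcal{A}})_{t\ge0}$ on $\mathcal{H}$; solutions of the system are given by $(u,u_t,y,y_t)(t)=e^{t\mathcal{A}}U_0$ with energy $E(t)=\frac12\|e^{t\mathcal{A}}U_0\|^2_{\mathcal{H}}$. *)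

theory Defs
  imports "HOL-Analysis.Analysis"
begin

section \<open>Square integrable functions modulo equality almost everywhere\<close>

definition sq_integrable :: "('a::euclidean_space \<Rightarrow> 'b::euclidean_space) \<Rightarrow> bool" where
  "sq_integrable f \<longleftrightarrow> f \<in> borel_measurable lborel \<and> integrable lborel (\<lambda>x. (norm (f x))\<^sup>2)"

lemma sq_integrable_zero: "sq_integrable (\<lambda>x. 0)"
  by (simp add: sq_integrable_def)

lemma sq_integrable_add:
  assumes "sq_integrable f" "sq_integrable g"
  shows "sq_integrable (\<lambda>x. f x + g x)"
proof -
  have [measurable]: "f \<in> borel_measurable lborel" "g \<in> borel_measurable lborel"
    and i: "integrable lborel (\<lambda>x. (norm (f x))\<^sup>2)" "integrable lborel (\<lambda>x. (norm (g x))\<^sup>2)"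
    using assms by (auto simp: sq_integrable_def)
  have *: "(norm (u + v))\<^sup>2 \<le> 2 * (norm u)\<^sup>2 + 2 * (norm v)\<^sup>2" for u v :: 'b
  proof -
    have "(norm (u + v))\<^sup>2 \<le> (norm u + norm v)\<^sup>2"
      by (intro power_mono norm_triangle_ineq) auto
    also have "\<dots> \<le> 2 * (norm u)\<^sup>2 + 2 * (norm v)\<^sup>2"
      using sum_squares_bound[of "norm u" "norm v"] by (simp add: power2_sum)
    finally show ?thesis .
  qed
  have "integrable lborel (\<lambda>x. (norm (f x + g x))\<^sup>2)"
  proof (rule Bochner_Integration.integrable_bound)
    show "integrable lborel (\<lambda>x. 2 * (norm (f x))\<^sup>2 + 2 * (norm (g x))\<^sup>2)"
      using i by auto
    show "AE x in lborel. norm ((norm (f x + g x))\<^sup>2)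
        \<le> norm (2 * (norm (f x))\<^sup>2 + 2 * (norm (g x))\<^sup>2)"
      using * by (auto intro!: AE_I2)
  qed measurable
  then show ?thesis by (simp add: sq_integrable_def)
qed

lemma sq_integrable_scaleR:
  assumes "sq_integrable f"
  shows "sq_integrable (\<lambda>x. r *\<^sub>R f x)"
  using assms by (auto simp: sq_integrable_def power_mult_distrib)

lemma sq_integrable_uminus:
  assumes "sq_integrable f"
  shows "sq_integrable (\<lambda>x. - f x)"
  using sq_integrable_scaleR[OF assms, of "-1"] by simp

lemma sq_integrable_inner:
  assumes "sq_integrable f" "sq_integrable g"
  shows "integrable lborel (\<lambda>x. f x \<bullet> g x)"
proof (rule Bochner_Integration.integrable_bound)
  have [measurable]: "f \<in> borel_measurable lborel" "g \<in> borel_measurable lborel"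
    using assms by (auto simp: sq_integrable_def)
  show "(\<lambda>x. f x \<bullet> g x) \<in> borel_measurable lborel" by measurable
  show "integrable lborel (\<lambda>x. (norm (f x))\<^sup>2 + (norm (g x))\<^sup>2)"
    using assms by (auto simp: sq_integrable_def)
  have "\<bar>u \<bullet> v\<bar> \<le> (norm u)\<^sup>2 + (norm v)\<^sup>2" for u v :: 'b
  proof -
    have "\<bar>u \<bullet> v\<bar> \<le> norm u * norm v" by (rule Cauchy_Schwarz_ineq2)
    also have "\<dots> \<le> 2 * norm u * norm v" by simp
    also have "\<dots> \<le> (norm u)\<^sup>2 + (norm v)\<^sup>2" by (rule sum_squares_bound)
    finally show ?thesis .
  qed
  then show "AE x in lborel. norm (f x \<bullet> g x) \<le> norm ((norm (f x))\<^sup>2 + (norm (g x))\<^sup>2)"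
    by (auto intro!: AE_I2)
qed

lemma sq_integrable_component:
  assumes "sq_integrable f"
  shows "sq_integrable (\<lambda>x. f x \<bullet> e)"
proof -
  have [measurable]: "f \<in> borel_measurable lborel"
    and i: "integrable lborel (\<lambda>x. (norm (f x))\<^sup>2)"
    using assms by (auto simp: sq_integrable_def)
  have "integrable lborel (\<lambda>x. (norm (f x \<bullet> e))\<^sup>2)"
  proof (rule Bochner_Integration.integrable_bound)
    show "integrable lborel (\<lambda>x. (norm e)\<^sup>2 * (norm (f x))\<^sup>2)"
      using i by auto
    have "(norm (u \<bullet> e))\<^sup>2 \<le> (norm e)\<^sup>2 * (norm u)\<^sup>2" for u :: 'b
      using power_mono[OF Cauchy_Schwarz_ineq2[of u e], of 2]
      by (simp add: power_mult_distrib mult.commute)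
    then show "AE x in lborel. norm ((norm (f x \<bullet> e))\<^sup>2) \<le> norm ((norm e)\<^sup>2 * (norm (f x))\<^sup>2)"
      by (auto intro!: AE_I2)
  qed measurable
  then show ?thesis by (simp add: sq_integrable_def)
qed

definition l2_rel :: "('a::euclidean_space \<Rightarrow> 'b::euclidean_space) \<Rightarrow> ('a \<Rightarrow> 'b) \<Rightarrow> bool" where
  "l2_rel f g \<longleftrightarrow> sq_integrable f \<and> sq_integrable g \<and> (AE x in lborel. f x = g x)"

lemma part_equivp_l2_rel: "part_equivp l2_rel"
proof (rule part_equivpI)
  show "\<exists>f. l2_rel f f"
    by (rule exI[of _ "\<lambda>x. 0"]) (simp add: l2_rel_def sq_integrable_zero)
  show "symp l2_rel"
    by (auto simp: symp_def l2_rel_def)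
  show "transp l2_rel"
    unfolding transp_def l2_rel_def by (auto elim: AE_mp)
qed

lemma integral_inner_self_eq_0_iff:
  assumes "sq_integrable f"
  shows "(\<integral>x. f x \<bullet> f x \<partial>lborel) = 0 \<longleftrightarrow> l2_rel f (\<lambda>x. 0)"
  using integral_nonneg_eq_0_iff_AE[OF sq_integrable_inner[OF assms assms]]
  by (simp add: l2_rel_def sq_integrable_zero assms)

text \<open>
  The Hilbert space of square integrable functions on the whole of the Euclidean space
  \<open>'a\<close> with values in \<open>'b\<close>. For \<open>f\<close> not square integrable, \<open>abs_l2 f\<close> is unspecified.
\<close>

quotient_type (overloaded) ('a, 'b) l2 =
  "'a::euclidean_space \<Rightarrow> 'b::euclidean_space" / partial: l2_rel
  by (rule part_equivp_l2_rel)

instantiation l2 :: (euclidean_space, euclidean_space) real_inner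
begin

lift_definition zero_l2 :: "('a, 'b) l2" is "\<lambda>x. 0"
  by (simp add: l2_rel_def sq_integrable_zero)

lift_definition plus_l2 :: "('a, 'b) l2 \<Rightarrow> ('a, 'b) l2 \<Rightarrow> ('a, 'b) l2" is "\<lambda>f g x. f x + g x"
  unfolding l2_rel_def by (auto intro: sq_integrable_add)

lift_definition uminus_l2 :: "('a, 'b) l2 \<Rightarrow> ('a, 'b) l2" is "\<lambda>f x. - f x"
  unfolding l2_rel_def by (auto intro: sq_integrable_uminus)

lift_definition scaleR_l2 :: "real \<Rightarrow> ('a, 'b) l2 \<Rightarrow> ('a, 'b) l2" is "\<lambda>r f x. r *\<^sub>R f x"
  unfolding l2_rel_def by (auto intro: sq_integrable_scaleR)

lift_definition inner_l2 :: "('a, 'b) l2 \<Rightarrow> ('a, 'b) l2 \<Rightarrow> real" is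
  "\<lambda>f g. \<integral>x. f x \<bullet> g x \<partial>lborel"
proof -
  fix f f' g g' :: "'a \<Rightarrow> 'b"
  assume *: "l2_rel f f'" "l2_rel g g'"
  show "(\<integral>x. f x \<bullet> g x \<partial>lborel) = (\<integral>x. f' x \<bullet> g' x \<partial>lborel)"
  proof (rule integral_cong_AE)
    show "AE x in lborel. f x \<bullet> g x = f' x \<bullet> g' x"
      using * unfolding l2_rel_def by auto
  qed (use * in \<open>auto simp: l2_rel_def sq_integrable_def\<close>)
qed

definition minus_l2 :: "('a, 'b) l2 \<Rightarrow> ('a, 'b) l2 \<Rightarrow> ('a, 'b) l2" where
  "minus_l2 f g = f + - g"

definition norm_l2 :: "('a, 'b) l2 \<Rightarrow> real" where
  "norm_l2 f = sqrt (f \<bullet> f)"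

definition sgn_l2 :: "('a, 'b) l2 \<Rightarrow> ('a, 'b) l2" where
  "sgn_l2 f = inverse (norm f) *\<^sub>R f"

definition dist_l2 :: "('a, 'b) l2 \<Rightarrow> ('a, 'b) l2 \<Rightarrow> real" where
  "dist_l2 f g = norm (f - g)"

definition uniformity_l2 :: "(('a, 'b) l2 \<times> ('a, 'b) l2) filter" where
  "uniformity_l2 = (INF e\<in>{0<..}. principal {(f, g). dist f g < e})"

definition open_l2 :: "('a, 'b) l2 set \<Rightarrow> bool" where
  "open_l2 U \<longleftrightarrow> (\<forall>f\<in>U. eventually (\<lambda>(f', g). f' = f \<longrightarrow> g \<in> U) uniformity)"

instance
proof
  fix f g h :: "('a, 'b) l2" and r s :: real and U :: "('a, 'b) l2 set"
  show "f + g + h = f + (g + h)"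
    by transfer (auto simp: l2_rel_def add.assoc intro!: sq_integrable_add)
  show "f + g = g + f"
    by transfer (auto simp: l2_rel_def add.commute intro!: sq_integrable_add)
  show "0 + f = f"
    by transfer (auto simp: l2_rel_def)
  show "- f + f = 0"
    by transfer (auto simp: l2_rel_def sq_integrable_zero)
  show "f - g = f + - g"
    by (rule minus_l2_def)
  show "r *\<^sub>R (f + g) = r *\<^sub>R f + r *\<^sub>R g"
    by transfer (auto simp: l2_rel_def scaleR_add_right[symmetric]
        intro!: sq_integrable_add sq_integrable_scaleR)
  show "(r + s) *\<^sub>R f = r *\<^sub>R f + s *\<^sub>R f"
    by transfer (auto simp: l2_rel_def scaleR_add_left[symmetric] intro!: sq_integrable_scaleR)
  show "r *\<^sub>R s *\<^sub>R f = (r * s) *\<^sub>R f"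
    by transfer (auto simp: l2_rel_def intro!: sq_integrable_scaleR)
  show "1 *\<^sub>R f = f"
    by transfer (auto simp: l2_rel_def)
  show "dist f g = norm (f - g)"
    by (rule dist_l2_def)
  show "sgn f = inverse (norm f) *\<^sub>R f"
    by (rule sgn_l2_def)
  show "uniformity = (INF e\<in>{0<..}. principal {(f::('a, 'b) l2, g). dist f g < e})"
    by (rule uniformity_l2_def)
  show "open U \<longleftrightarrow> (\<forall>f\<in>U. eventually (\<lambda>(f', g). f' = f \<longrightarrow> g \<in> U) uniformity)"
    by (rule open_l2_def)
  show "f \<bullet> g = g \<bullet> f"
    by transfer (simp add: inner_commute)
  show "(f + g) \<bullet> h = f \<bullet> h + g \<bullet> h"
    by transfer (simp add: l2_rel_def inner_add_left sq_integrable_inner)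
  show "r *\<^sub>R f \<bullet> g = r * (f \<bullet> g)"
    by transfer simp
  show "0 \<le> f \<bullet> f"
    by transfer simp
  show "f \<bullet> f = 0 \<longleftrightarrow> f = 0"
    by transfer (metis integral_inner_self_eq_0_iff l2_rel_def)
  show "norm f = sqrt (f \<bullet> f)"
    by (rule norm_l2_def)
qed

end

lift_definition l2_component :: "'b \<Rightarrow> ('a::euclidean_space, 'b::euclidean_space) l2 \<Rightarrow> ('a, real) l2"
  is "\<lambda>e f x. f x \<bullet> e"
  unfolding l2_rel_def by (auto intro: sq_integrable_component)

text \<open>
  \<open>L\<^sup>2(\<Omega>)\<close> is identified with the functions vanishing almost everywhere outside \<open>\<Omega>\<close>
  (extension by zero), so that its norm and inner product are those of the type \<open>l2\<close>.
\<close>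

lift_definition vanishes_outside :: "'a set \<Rightarrow> ('a::euclidean_space, 'b::euclidean_space) l2 \<Rightarrow> bool"
  is "\<lambda>\<Omega> f. AE x in lborel. x \<notin> \<Omega> \<longrightarrow> f x = 0"
proof -
  fix \<Omega> :: "'a set" and f g :: "'a \<Rightarrow> 'b"
  assume "l2_rel f g"
  then have "AE x in lborel. f x = g x" by (simp add: l2_rel_def)
  then show "(AE x in lborel. x \<notin> \<Omega> \<longrightarrow> f x = 0) = (AE x in lborel. x \<notin> \<Omega> \<longrightarrow> g x = 0)"
    by (intro AE_cong_simp refl iffI; elim AE_mp; auto)
qed

definition L2 :: "'a set \<Rightarrow> ('a::euclidean_space, 'b::euclidean_space) l2 set" where
  "L2 \<Omega> = {f. vanishes_outside \<Omega> f}"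


section \<open>Sobolev spaces\<close>

definition partial_deriv :: "'a \<Rightarrow> ('a::euclidean_space \<Rightarrow> real) \<Rightarrow> 'a \<Rightarrow> real" where
  "partial_deriv e f x = frechet_derivative f (at x) e"

definition gradient :: "('a::euclidean_space \<Rightarrow> real) \<Rightarrow> 'a \<Rightarrow> 'a" where
  "gradient f x = (\<Sum>e\<in>Basis. partial_deriv e f x *\<^sub>R e)"

primrec C_k :: "nat \<Rightarrow> ('a::euclidean_space \<Rightarrow> real) \<Rightarrow> bool" where
  "C_k 0 f \<longleftrightarrow> continuous_on UNIV f"
| "C_k (Suc k) f \<longleftrightarrow> (\<forall>x. f differentiable (at x)) \<and> (\<forall>e\<in>Basis. C_k k (partial_deriv e f))"

definition test_functions :: "'a set \<Rightarrow> ('a::euclidean_space \<Rightarrow> real) set" where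
  "test_functions \<Omega> =
    {\<phi>. (\<forall>k. C_k k \<phi>) \<and> compact (closure {x. \<phi> x \<noteq> 0}) \<and> closure {x. \<phi> x \<noteq> 0} \<subseteq> \<Omega>}"

text \<open>
  Test functions and their partial derivatives are continuous with compact support, hence
  square integrable, so \<open>abs_l2\<close> is only ever applied to square integrable functions below.
  The integration-by-parts identities are integrals over \<open>\<Omega>\<close>, as \<open>\<phi>\<close> is supported in \<open>\<Omega>\<close>.
\<close>

definition has_weak_partial ::
  "'a set \<Rightarrow> 'a \<Rightarrow> ('a::euclidean_space, real) l2 \<Rightarrow> ('a, real) l2 \<Rightarrow> bool" where
  "has_weak_partial \<Omega> e u g \<longleftrightarrow>
    (\<forall>\<phi>\<in>test_functions \<Omega>. u \<bullet> abs_l2 (partial_deriv e \<phi>) = - (g \<bullet> abs_l2 \<phi>))"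

definition has_weak_gradient ::
  "'a set \<Rightarrow> ('a::euclidean_space, real) l2 \<Rightarrow> ('a, 'a) l2 \<Rightarrow> bool" where
  "has_weak_gradient \<Omega> u G \<longleftrightarrow> (\<forall>e\<in>Basis. has_weak_partial \<Omega> e u (l2_component e G))"

definition weak_gradient :: "'a set \<Rightarrow> ('a::euclidean_space, real) l2 \<Rightarrow> ('a, 'a) l2" where
  "weak_gradient \<Omega> u = (THE G. G \<in> L2 \<Omega> \<and> has_weak_gradient \<Omega> u G)"

definition has_weak_div ::
  "'a set \<Rightarrow> ('a::euclidean_space, 'a) l2 \<Rightarrow> ('a, real) l2 \<Rightarrow> bool" where
  "has_weak_div \<Omega> F w \<longleftrightarrow>
    (\<forall>\<phi>\<in>test_functions \<Omega>. F \<bullet> abs_l2 (gradient \<phi>) = - (w \<bullet> abs_l2 \<phi>))"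

definition weak_div :: "'a set \<Rightarrow> ('a::euclidean_space, 'a) l2 \<Rightarrow> ('a, real) l2" where
  "weak_div \<Omega> F = (THE w. w \<in> L2 \<Omega> \<and> has_weak_div \<Omega> F w)"

definition H1 :: "'a set \<Rightarrow> ('a::euclidean_space, real) l2 set" where
  "H1 \<Omega> = {u \<in> L2 \<Omega>. \<exists>G\<in>L2 \<Omega>. has_weak_gradient \<Omega> u G}"

text \<open>The closure of the test functions in the norm of \<open>H\<^sup>1(\<Omega>)\<close>.\<close>

definition H1_0 :: "'a set \<Rightarrow> ('a::euclidean_space, real) l2 set" where
  "H1_0 \<Omega> = {u \<in> H1 \<Omega>. \<forall>\<delta>>0. \<exists>\<phi>\<in>test_functions \<Omega>.
    sqrt ((norm (u - abs_l2 \<phi>))\<^sup>2 + (norm (weak_gradient \<Omega> u - abs_l2 (gradient \<phi>)))\<^sup>2) < \<delta>}"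

definition H2 :: "'a set \<Rightarrow> ('a::euclidean_space, real) l2 set" where
  "H2 \<Omega> = {u \<in> H1 \<Omega>. \<forall>e\<in>Basis. l2_component e (weak_gradient \<Omega> u) \<in> H1 \<Omega>}"

definition weak_laplacian :: "'a set \<Rightarrow> ('a::euclidean_space, real) l2 \<Rightarrow> ('a, real) l2" where
  "weak_laplacian \<Omega> u = weak_div \<Omega> (weak_gradient \<Omega> u)"

text \<open>
  Near each boundary point, \<open>\<Omega>\<close> is the region above the graph, in the direction of a unit
  vector \<open>e\<close>, of a Lipschitz function on the hyperplane orthogonal to \<open>e\<close>.
\<close>

definition lipschitz_boundary :: "'a::euclidean_space set \<Rightarrow> bool" where
  "lipschitz_boundary \<Omega> \<longleftrightarrow>
    (\<forall>p\<in>frontier \<Omega>. \<exists>r>0. \<exists>e g C. norm e = 1 \<and> C-lipschitz_on {x. x \<bullet> e = 0} (g :: 'a \<Rightarrow> real) \<and>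
      \<Omega> \<inter> ball p r = {x \<in> ball p r. x \<bullet> e > g (x - (x \<bullet> e) *\<^sub>R e)})"


section \<open>Semigroups on a normed space given by a carrier and a norm\<close>

definition contraction_C0_semigroup ::
  "'h::real_vector set \<Rightarrow> ('h \<Rightarrow> real) \<Rightarrow> (real \<Rightarrow> 'h \<Rightarrow> 'h) \<Rightarrow> bool" where
  "contraction_C0_semigroup H N S \<longleftrightarrow>
    (\<forall>t\<ge>0. \<forall>U\<in>H. S t U \<in> H) \<and>
    (\<forall>t\<ge>0. \<forall>U\<in>H. \<forall>V\<in>H. S t (U + V) = S t U + S t V) \<and>
    (\<forall>t\<ge>0. \<forall>r. \<forall>U\<in>H. S t (r *\<^sub>R U) = r *\<^sub>R S t U) \<and>
    (\<forall>t\<ge>0. \<forall>U\<in>H. N (S t U) \<le> N U) \<and>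
    (\<forall>U\<in>H. S 0 U = U) \<and>
    (\<forall>s\<ge>0. \<forall>t\<ge>0. \<forall>U\<in>H. S (s + t) U = S s (S t U)) \<and>
    (\<forall>U\<in>H. ((\<lambda>t. N (S t U - U)) \<longlongrightarrow> 0) (at_right 0))"

definition has_generator_value ::
  "('h::real_vector \<Rightarrow> real) \<Rightarrow> (real \<Rightarrow> 'h \<Rightarrow> 'h) \<Rightarrow> 'h \<Rightarrow> 'h \<Rightarrow> bool" where
  "has_generator_value N S U V \<longleftrightarrow>
    ((\<lambda>t. N ((1 / t) *\<^sub>R (S t U - U) - V)) \<longlongrightarrow> 0) (at_right 0)"

definition is_generator ::
  "'h::real_vector set \<Rightarrow> ('h \<Rightarrow> real) \<Rightarrow> (real \<Rightarrow> 'h \<Rightarrow> 'h) \<Rightarrow> 'h set \<Rightarrow> ('h \<Rightarrow> 'h) \<Rightarrow> bool" where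
  "is_generator H N S D A \<longleftrightarrow>
    D = {U \<in> H. \<exists>V\<in>H. has_generator_value N S U V} \<and>
    (\<forall>U\<in>D. A U \<in> H \<and> has_generator_value N S U (A U))"


section \<open>The coupled system\<close>

type_synonym 'a state = "('a, real) l2 \<times> ('a, real) l2 \<times> ('a, real) l2 \<times> ('a, real) l2"

definition energy_space :: "'a::euclidean_space set \<Rightarrow> 'a state set" where
  "energy_space \<Omega> = H1_0 \<Omega> \<times> L2 \<Omega> \<times> H1_0 \<Omega> \<times> L2 \<Omega>"

definition energy_norm :: "real \<Rightarrow> 'a::euclidean_space set \<Rightarrow> 'a state \<Rightarrow> real" where
  "energy_norm a \<Omega> = (\<lambda>(u, v, y, z).
    sqrt (a * (norm (weak_gradient \<Omega> u))\<^sup>2 + (norm v)\<^sup>2 + (norm (weak_gradient \<Omega> y))\<^sup>2 + (norm z)\<^sup>2))"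

definition system_domain :: "real \<Rightarrow> real \<Rightarrow> 'a::euclidean_space set \<Rightarrow> 'a state set" where
  "system_domain a b \<Omega> = {(u, v, y, z). (u, v, y, z) \<in> energy_space \<Omega> \<and>
    v \<in> H1_0 \<Omega> \<and> z \<in> H1_0 \<Omega> \<and>
    (\<exists>w\<in>L2 \<Omega>. has_weak_div \<Omega> (a *\<^sub>R weak_gradient \<Omega> u + b *\<^sub>R weak_gradient \<Omega> v) w) \<and>
    y \<in> H2 \<Omega> \<inter> H1_0 \<Omega>}"

definition system_operator ::
  "real \<Rightarrow> real \<Rightarrow> real \<Rightarrow> 'a::euclidean_space set \<Rightarrow> 'a state \<Rightarrow> 'a state" where
  "system_operator a b c \<Omega> = (\<lambda>(u, v, y, z).
    (v, weak_div \<Omega> (a *\<^sub>R weak_gradient \<Omega> u + b *\<^sub>R weak_gradient \<Omega> v) - c *\<^sub>R z,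
     z, weak_laplacian \<Omega> y + c *\<^sub>R v))"

end

theory Submission
  imports Defs
begin

text \<open>
  Only the first equation is damped, and the damping reaches \<open>y\<close> only through the coupling. When
  \<open>y\<close> oscillates at high frequency, the strongly damped component \<open>u\<close> hardly responds, so that
  almost no energy is lost during a prescribed time.

  Write \<open>q(U) = |\<nabla>y|\<^sup>2 + |z|\<^sup>2 - a |\<nabla>u|\<^sup>2 - |v|\<^sup>2\<close> for \<open>U = (u, v, y, z)\<close>; this is at most the squared
  energy norm. Along a solution \<open>U(t) = S t U\<close>, Green's formula gives
  \<open>q' = 2 b |\<nabla>v|\<^sup>2 + 4 c (z \<bullet> v)\<close> (\<open>system_energy_balance\<close>). If moreover \<open>U = A W\<close>, then \<open>S t U = A (S t W)\<close>;
  hence \<open>z = \<Delta>y' + c v'\<close> for components \<open>y'\<close>, \<open>v'\<close> of \<open>S t W\<close>, whose norm is at most the norm of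
  \<open>W\<close>. Integrating \<open>z \<bullet> v\<close> by parts and absorbing \<open>|\<nabla>v|\<close> into the first term bounds \<open>q'\<close> below by
  \<open>- 2 (c\<^sup>2 / b \<omega>\<^sup>2 + 2 c\<^sup>2 \<omega> \<rho>)\<close>, where \<open>\<omega>\<close> and \<open>\<rho>\<close> bound the norms of \<open>W\<close> and \<open>U\<close>
  (\<open>system_balance_lower_bound\<close>). So \<open>q\<close> loses little over a fixed time if \<open>\<omega>\<close> is small
  compared with \<open>\<rho>\<close>.

  Such data are \<open>W = (0, 0, \<phi>, 0)\<close> and \<open>U = A W = (0, 0, 0, \<Delta>\<phi>)\<close> with a test function \<open>\<phi>\<close> for which
  \<open>|\<nabla>\<phi>|\<close> is small compared with \<open>|\<Delta>\<phi>|\<close> (\<open>exists_oscillating_test_function\<close>). For them \<open>q(U)\<close> is the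
  whole squared norm, and uniform decay fails for every choice of constants.

  Two ingredients remain. The weak derivatives in the energy norm are descriptions, which have
  to be shown well defined: this is the fundamental lemma of the calculus of variations
  (\<open>L2_eq_0_if_orthogonal_to_test_functions\<close>), for which smooth bumps are constructed. And the
  differential inequality for \<open>q\<close> is integrated in \<open>quadratic_form_lower_bound\<close>, directly from
  the one-sided difference quotients that define the generator.
\<close>


section \<open>Smooth functions\<close>

lemma partial_deriv_eqI:
  assumes "(f has_derivative D) (at x)"
  shows "partial_deriv e f x = D e"
  using frechet_derivative_at[OF assms] by (simp add: partial_deriv_def)

lemma has_derivative_partial_deriv:
  assumes "f differentiable (at x)"
  shows "(f has_derivative (\<lambda>e. partial_deriv e f x)) (at x)"
  using assms frechet_derivative_works[of f "at x"] by (simp add: partial_deriv_def)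

lemma C_k_continuous: "C_k k f \<Longrightarrow> continuous_on UNIV f"
  by (cases k) (auto simp: continuous_on_eq_continuous_within differentiable_imp_continuous_within)

lemma C_k_const: "C_k k (\<lambda>x. r)"
proof (induction k arbitrary: r)
  case (Suc k)
  have "partial_deriv e (\<lambda>x. r) = (\<lambda>x. 0)" for e :: 'a
    by (rule ext, rule partial_deriv_eqI[of _ "\<lambda>_. 0"]) simp
  with Suc show ?case by simp
qed simp

lemma partial_deriv_add:
  assumes "\<And>x. f differentiable (at x)" "\<And>x. g differentiable (at x)"
  shows "partial_deriv e (\<lambda>x. f x + g x) = (\<lambda>x. partial_deriv e f x + partial_deriv e g x)"
  by (rule ext, rule partial_deriv_eqI, intro has_derivative_add has_derivative_partial_deriv assms)

lemma partial_deriv_cmult: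
  assumes "\<And>x. f differentiable (at x)"
  shows "partial_deriv e (\<lambda>x. r * f x) = (\<lambda>x. r * partial_deriv e f x)"
  by (rule ext, rule partial_deriv_eqI, intro has_derivative_mult_right has_derivative_partial_deriv assms)

lemma partial_deriv_mult:
  assumes "\<And>x. f differentiable (at x)" "\<And>x. g differentiable (at x)"
  shows "partial_deriv e (\<lambda>x. f x * g x) = (\<lambda>x. f x * partial_deriv e g x + partial_deriv e f x * g x)"
  by (rule ext, rule partial_deriv_eqI[OF has_derivative_mult[OF has_derivative_partial_deriv has_derivative_partial_deriv]])
    (use assms in auto)

lemma partial_deriv_rescale:
  assumes "\<And>x. f differentiable (at x)"
  shows "partial_deriv e (\<lambda>x. f (r *\<^sub>R (x - p))) = (\<lambda>x. r * partial_deriv e f (r *\<^sub>R (x - p)))"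
proof
  fix x
  interpret D: linear "\<lambda>e. partial_deriv e f (r *\<^sub>R (x - p))"
    using has_derivative_partial_deriv[OF assms] has_derivative_linear by blast
  have "((\<lambda>x. f (r *\<^sub>R (x - p))) has_derivative (\<lambda>e. partial_deriv (r *\<^sub>R e) f (r *\<^sub>R (x - p)))) (at x)"
    by (rule has_derivative_compose[of "\<lambda>x. r *\<^sub>R (x - p)" "\<lambda>e. r *\<^sub>R e",
          OF _ has_derivative_partial_deriv[OF assms]])
      (auto intro!: derivative_eq_intros)
  from partial_deriv_eqI[OF this, of e]
  show "partial_deriv e (\<lambda>x. f (r *\<^sub>R (x - p))) x = r * partial_deriv e f (r *\<^sub>R (x - p))"
    by (simp add: D.scaleR)
qed

lemma C_k_add: "C_k k f \<Longrightarrow> C_k k g \<Longrightarrow> C_k k (\<lambda>x. f x + g x)"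
  by (induction k arbitrary: f g) (auto intro!: continuous_on_add simp: partial_deriv_add)

lemma C_k_cmult: "C_k k f \<Longrightarrow> C_k k (\<lambda>x. r * f x)"
  by (induction k arbitrary: f) (auto intro!: continuous_intros simp: partial_deriv_cmult)

lemma C_k_rescale: "C_k k f \<Longrightarrow> C_k k (\<lambda>x. f (r *\<^sub>R (x - p)))"
proof (induction k arbitrary: f)
  case 0
  then show ?case
    by (auto intro!: continuous_on_compose2[of UNIV f] continuous_intros)
next
  case (Suc k)
  then have d: "f differentiable (at x)" for x by simp
  have "(\<lambda>x. f (r *\<^sub>R (x - p))) differentiable (at x)" for x
    using differentiable_chain_at[of "\<lambda>x. r *\<^sub>R (x - p)" x f] d
    by (simp add: o_def)
  with Suc d show ?case
    by (simp add: partial_deriv_rescale C_k_cmult)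
qed

text \<open>
  Smoothness is defined by recursion on the order of differentiation, so it is inherited by
  all members of a class of functions that is closed under taking partial derivatives.
\<close>

lemma C_k_of_closed_class:
  assumes "\<And>f x. P f \<Longrightarrow> f differentiable (at x)"
    and "\<And>f e. P f \<Longrightarrow> e \<in> Basis \<Longrightarrow> P (partial_deriv e f)" and "P f"
  shows "C_k k f"
  using assms(3)
proof (induction k arbitrary: f)
  case 0
  then show ?case
    by (auto simp: continuous_on_eq_continuous_within
        intro!: differentiable_imp_continuous_within assms(1))
qed (auto simp: assms)


text \<open>
  The support, being a closure, is awkward to determine, but it lies in every compact set outside
  which the function vanishes.
\<close>

lemma test_functions_supportI:
  assumes "\<And>k. C_k k f" "compact K" "K \<subseteq> \<Omega>" "{x. f x \<noteq> 0} \<subseteq> K"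
  shows "f \<in> test_functions \<Omega>"
proof -
  have "closure {x. f x \<noteq> 0} \<subseteq> K"
    using assms(2,4) by (simp add: closure_minimal compact_imp_closed)
  moreover from this compact_Int_closed[OF assms(2) closed_closure[of "{x. f x \<noteq> 0}"]]
  have "compact (closure {x. f x \<noteq> 0})" by (simp only: Int_absorb1)
  ultimately show ?thesis
    using assms(1,3) by (auto simp: test_functions_def)
qed


section \<open>Smooth bumps supported in boxes\<close>

text \<open>
  With \<open>p = 1\<close> this is the classical flat function \<open>exp (- s / t)\<close>; admitting a polynomial
  factor in \<open>1 / t\<close> makes the class closed under differentiation.
\<close>

definition flat :: "real \<Rightarrow> real poly \<Rightarrow> real \<Rightarrow> real" where
  "flat s p t = (if 0 < t then poly p (1 / t) * exp (- (s / t)) else 0)"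

text \<open>The exponential beats the polynomial factor, which makes all derivatives vanish at 0.\<close>

lemma poly_times_exp_neg_tendsto_0:
  fixes p :: "real poly"
  assumes "0 < s"
  shows "((\<lambda>x. poly p x * exp (- (s * x))) \<longlongrightarrow> 0) at_top"
proof -
  have mono: "((\<lambda>x. x ^ k * exp (- (s * x))) \<longlongrightarrow> 0) at_top" for k
  proof -
    have "filterlim (\<lambda>x. s * x) at_top at_top"
      using assms by (intro filterlim_tendsto_pos_mult_at_top[OF tendsto_const]) (auto simp: filterlim_ident)
    from filterlim_compose[OF tendsto_power_div_exp_0 this, of k]
    have "((\<lambda>x. (1 / s ^ k) * ((s * x) ^ k / exp (s * x))) \<longlongrightarrow> (1 / s ^ k) * 0) at_top"
      by (intro tendsto_mult tendsto_const)
    then show ?thesis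
      using assms by (simp add: power_mult_distrib exp_minus field_simps)
  qed
  have "((\<lambda>x. \<Sum>i\<le>degree p. coeff p i * (x ^ i * exp (- (s * x)))) \<longlongrightarrow> (\<Sum>i\<le>degree p. coeff p i * 0)) at_top"
    by (intro tendsto_sum tendsto_mult tendsto_const mono)
  then show ?thesis
    by (simp add: poly_altdef sum_distrib_right mult.assoc)
qed

lemma flat_tendsto_0:
  assumes "0 < s"
  shows "(flat s p \<longlongrightarrow> 0) (at 0)"
proof -
  have "((\<lambda>t. poly p (inverse t) * exp (- (s * inverse t))) \<longlongrightarrow> 0) (at_right 0)"
    using filterlim_compose[OF poly_times_exp_neg_tendsto_0[OF assms] filterlim_inverse_at_top_right] .
  then have r: "(flat s p \<longlongrightarrow> 0) (at_right 0)"
    by (rule Lim_transform_eventually)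
      (auto simp: flat_def eventually_at_filter field_simps)
  have l: "(flat s p \<longlongrightarrow> 0) (at_left 0)"
    by (rule Lim_transform_eventually[OF tendsto_const])
      (auto simp: flat_def eventually_at_filter)
  show ?thesis
    using l r by (simp add: filterlim_split_at)
qed

lemma flat_has_derivative:
  assumes "0 < s"
  shows "(flat s p has_real_derivative flat s ([:0, 0, 1:] * (smult s p - pderiv p)) t) (at t)"
proof -
  consider "t < 0" | "t = 0" | "0 < t" by linarith
  then show ?thesis
  proof cases
    case 1
    have "((\<lambda>t. 0) has_real_derivative 0) (at t)" by simp
    then have "(flat s p has_real_derivative 0) (at t)"
      by (rule has_field_derivative_transform_within[where d = "- t"]) (use 1 in \<open>auto simp: flat_def dist_real_def\<close>)
    then show ?thesis using 1 by (simp add: flat_def)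
  next
    case 2
    have "(\<lambda>h. (flat s p (0 + h) - flat s p 0) / h) = flat s (pCons 0 p)"
      by (auto simp: flat_def fun_eq_iff)
    then show ?thesis
      using flat_tendsto_0[OF assms, of "pCons 0 p"] 2
      by (simp add: DERIV_def) (simp add: flat_def)
  next
    case 3
    have "((\<lambda>t. poly p (1 / t) * exp (- (s / t))) has_real_derivative
        poly ([:0, 0, 1:] * (smult s p - pderiv p)) (1 / t) * exp (- (s / t))) (at t)"
      using 3 by (auto intro!: derivative_eq_intros simp: field_simps power2_eq_square)
    then have "(flat s p has_real_derivative
        poly ([:0, 0, 1:] * (smult s p - pderiv p)) (1 / t) * exp (- (s / t))) (at t)"
      by (rule has_field_derivative_transform_within[where d = t]) (use 3 in \<open>auto simp: flat_def dist_real_def\<close>)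
    then show ?thesis using 3 by (simp add: flat_def)
  qed
qed

text \<open>
  The constants belong to the class because the chain rule produces the factors \<open>e \<bullet> v\<close>.
\<close>

inductive flat_algebra :: "('a::euclidean_space \<Rightarrow> real) \<Rightarrow> bool" where
  flat: "0 < s \<Longrightarrow> flat_algebra (\<lambda>x. flat s p (x \<bullet> v + r))"
| const: "flat_algebra (\<lambda>x. r)"
| add: "flat_algebra f \<Longrightarrow> flat_algebra g \<Longrightarrow> flat_algebra (\<lambda>x. f x + g x)"
| mult: "flat_algebra f \<Longrightarrow> flat_algebra g \<Longrightarrow> flat_algebra (\<lambda>x. f x * g x)"

lemma flat_compose_has_derivative:
  assumes "0 < s"
  shows "((\<lambda>x. flat s p (x \<bullet> v + r)) has_derivative
    (\<lambda>e. flat s ([:0, 0, 1:] * (smult s p - pderiv p)) (x \<bullet> v + r) * (e \<bullet> v))) (at x)"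
  by (rule has_derivative_compose[of "\<lambda>x. x \<bullet> v + r" "\<lambda>e. e \<bullet> v",
        OF _ flat_has_derivative[OF assms, unfolded has_field_derivative_def]])
    (auto intro!: derivative_eq_intros)

lemma flat_algebra_differentiable: "flat_algebra f \<Longrightarrow> f differentiable (at x)"
  by (induction rule: flat_algebra.induct)
    (auto intro: flat_compose_has_derivative differentiableI simp: differentiable_mult)

lemma flat_algebra_partial_deriv: "flat_algebra f \<Longrightarrow> flat_algebra (partial_deriv e f)"
proof (induction rule: flat_algebra.induct)
  case (flat s p v r)
  have "partial_deriv e (\<lambda>x. flat s p (x \<bullet> v + r)) =
      (\<lambda>x. flat s ([:0, 0, 1:] * (smult s p - pderiv p)) (x \<bullet> v + r) * (e \<bullet> v))"
    by (rule ext, rule partial_deriv_eqI, rule flat_compose_has_derivative[OF flat])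
  then show ?case
    using flat_algebra.mult[OF flat_algebra.flat[OF flat] flat_algebra.const] by simp
next
  case (const r)
  have "partial_deriv e (\<lambda>x. r) = (\<lambda>x. 0)"
    by (rule ext, rule partial_deriv_eqI[of _ "\<lambda>_. 0"]) simp
  then show ?case by (simp add: flat_algebra.const)
next
  case (add f g)
  then show ?case
    by (simp add: partial_deriv_add flat_algebra_differentiable flat_algebra.add)
next
  case (mult f g)
  then show ?case
    by (simp add: partial_deriv_mult flat_algebra_differentiable flat_algebra.add flat_algebra.mult)
qed

lemma flat_algebra_C_k: "flat_algebra f \<Longrightarrow> C_k k f"
  using flat_algebra_differentiable flat_algebra_partial_deriv
  by (rule C_k_of_closed_class[where P = flat_algebra])

lemma flat_algebra_prod:
  assumes "finite I" "\<And>i. i \<in> I \<Longrightarrow> flat_algebra (f i)"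
  shows "flat_algebra (\<lambda>x. \<Prod>i\<in>I. f i x)"
  using assms by (induction I rule: finite_induct) (auto intro: flat_algebra.intros)

definition box_bump :: "real \<Rightarrow> 'a::euclidean_space \<Rightarrow> 'a \<Rightarrow> 'a \<Rightarrow> real" where
  "box_bump s l u x = (\<Prod>e\<in>Basis. flat s 1 (x \<bullet> e - l \<bullet> e) * flat s 1 (u \<bullet> e - x \<bullet> e))"

lemma box_bump_C_k:
  assumes "0 < s"
  shows "C_k k (box_bump s l u)"
proof -
  have "flat_algebra (\<lambda>x. flat s 1 (x \<bullet> e - l \<bullet> e))" for e
    using flat_algebra.flat[OF assms, of 1 e "- (l \<bullet> e)"] by simp
  moreover have "flat_algebra (\<lambda>x. flat s 1 (u \<bullet> e - x \<bullet> e))" for e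
    using flat_algebra.flat[OF assms, of 1 "- e" "u \<bullet> e"] by (simp add: algebra_simps)
  ultimately have "flat_algebra (box_bump s l u)"
    unfolding box_bump_def by (intro flat_algebra_prod flat_algebra.mult) auto
  then show ?thesis by (rule flat_algebra_C_k)
qed

lemma flat_one_bounds: "0 \<le> flat s 1 t" "0 < s \<Longrightarrow> flat s 1 t \<le> 1" "0 < flat s 1 t \<longleftrightarrow> 0 < t"
  by (auto simp: flat_def)

lemma box_bump_pos_iff: "0 < box_bump s l u x \<longleftrightarrow> x \<in> box l u"
proof
  assume pos: "0 < box_bump s l u x"
  have nz: "flat s 1 (x \<bullet> e - l \<bullet> e) * flat s 1 (u \<bullet> e - x \<bullet> e) \<noteq> 0" if "e \<in> Basis" for e
  proof
    assume "flat s 1 (x \<bullet> e - l \<bullet> e) * flat s 1 (u \<bullet> e - x \<bullet> e) = 0"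
    then have "box_bump s l u x = 0"
      unfolding box_bump_def by (intro prod_zero finite_Basis bexI[OF _ that])
    with pos show False by simp
  qed
  have "l \<bullet> e < x \<bullet> e \<and> x \<bullet> e < u \<bullet> e" if "e \<in> Basis" for e
    using nz[OF that] by (simp add: flat_def split: if_splits)
  then show "x \<in> box l u" by (simp add: mem_box)
next
  assume "x \<in> box l u"
  then have "0 < flat s 1 (x \<bullet> e - l \<bullet> e) * flat s 1 (u \<bullet> e - x \<bullet> e)" if "e \<in> Basis" for e
    using that by (simp add: mem_box flat_def)
  then show "0 < box_bump s l u x"
    unfolding box_bump_def by (rule prod_pos)
qed

lemma box_bump_bounds: "0 \<le> box_bump s l u x" "0 < s \<Longrightarrow> box_bump s l u x \<le> 1"
  unfolding box_bump_def
  by (rule prod_nonneg, simp add: flat_one_bounds)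
    (rule prod_le_1, simp add: flat_one_bounds mult_le_one)

lemma box_bump_test_function:
  assumes "0 < s" "cbox l u \<subseteq> \<Omega>"
  shows "box_bump s l u \<in> test_functions \<Omega>"
proof (rule test_functions_supportI[OF box_bump_C_k[OF assms(1)] compact_cbox assms(2)])
  have "{x. box_bump s l u x \<noteq> 0} = box l u"
    using box_bump_pos_iff[of s l u] box_bump_bounds(1)[of s l u]
    by (auto simp: less_le set_eq_iff)
  then show "{x. box_bump s l u x \<noteq> 0} \<subseteq> cbox l u"
    using box_subset_cbox by blast
qed

lemma box_bump_tendsto_indicator:
  "(\<lambda>n. box_bump (1 / real (Suc n)) l u x) \<longlonglongrightarrow> indicator (box l u) x"
proof (cases "x \<in> box l u")
  case True
  have f: "(\<lambda>n. flat (1 / real (Suc n)) 1 t) \<longlonglongrightarrow> 1" if "0 < t" for t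
  proof -
    have "(\<lambda>n. exp (- ((1 / real (Suc n)) / t))) \<longlonglongrightarrow> exp (- (0 / t))"
      using that by (intro tendsto_intros LIMSEQ_Suc[OF lim_1_over_n]) auto
    then show ?thesis using that by (simp add: flat_def)
  qed
  have "(\<lambda>n. box_bump (1 / real (Suc n)) l u x) \<longlonglongrightarrow> (\<Prod>e\<in>(Basis::'a set). 1 * 1)"
    unfolding box_bump_def using True by (intro tendsto_prod tendsto_mult f) (auto simp: mem_box)
  then show ?thesis using True by simp
next
  case False
  then have "box_bump s l u x = 0" for s
    using box_bump_pos_iff[of s l u x] box_bump_bounds(1)[of s l u x] by linarith
  with False show ?thesis by simp
qed


section \<open>Test functions and integration by parts\<close>

lemma test_function_C_k: "\<phi> \<in> test_functions \<Omega> \<Longrightarrow> C_k k \<phi>"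
  by (simp add: test_functions_def)

lemma test_function_differentiable: "\<phi> \<in> test_functions \<Omega> \<Longrightarrow> \<phi> differentiable (at x)"
  using test_function_C_k[of \<phi> \<Omega> "Suc 0"] by simp

lemma test_function_continuous: "\<phi> \<in> test_functions \<Omega> \<Longrightarrow> continuous_on UNIV \<phi>"
  using test_function_C_k C_k_continuous by blast

lemma test_function_support:
  assumes "\<phi> \<in> test_functions \<Omega>"
  shows "compact (closure {x. \<phi> x \<noteq> 0})" "closure {x. \<phi> x \<noteq> 0} \<subseteq> \<Omega>"
  using assms by (auto simp: test_functions_def)

lemma eq_0_outside_support: "x \<notin> closure {x. f x \<noteq> 0} \<Longrightarrow> f x = 0"
  using subsetD[OF closure_subset, of x "{x. f x \<noteq> 0}"] by (simp only: mem_Collect_eq) argo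

lemma partial_deriv_eq_0_outside_support:
  assumes "x \<notin> closure {x. f x \<noteq> 0}"
  shows "partial_deriv e f x = 0"
proof -
  have "((\<lambda>_. 0) has_derivative (\<lambda>_. 0)) (at x)" by simp
  then have "(f has_derivative (\<lambda>_. 0)) (at x)"
    by (rule has_derivative_transform_within_open[of _ _ _ _ "- closure {x. f x \<noteq> 0}"])
      (use assms closure_subset[of "{x. f x \<noteq> 0}"] in auto)
  then show ?thesis by (rule partial_deriv_eqI)
qed

lemma partial_deriv_test_function:
  assumes "\<phi> \<in> test_functions \<Omega>" "e \<in> Basis"
  shows "partial_deriv e \<phi> \<in> test_functions \<Omega>"
proof (rule test_functions_supportI[OF _ test_function_support[OF assms(1)]])
  show "C_k k (partial_deriv e \<phi>)" for k
    using test_function_C_k[OF assms(1), of "Suc k"] assms(2) by simp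
  show "{x. partial_deriv e \<phi> x \<noteq> 0} \<subseteq> closure {x. \<phi> x \<noteq> 0}"
    using partial_deriv_eq_0_outside_support by blast
qed

lemma test_functions_cmult:
  assumes "\<phi> \<in> test_functions \<Omega>"
  shows "(\<lambda>x. r * \<phi> x) \<in> test_functions \<Omega>"
proof (rule test_functions_supportI[OF _ test_function_support[OF assms]])
  show "C_k k (\<lambda>x. r * \<phi> x)" for k
    using test_function_C_k[OF assms] by (rule C_k_cmult)
  show "{x. r * \<phi> x \<noteq> 0} \<subseteq> closure {x. \<phi> x \<noteq> 0}"
  proof (rule subsetI, rule ccontr)
    fix x assume x: "x \<in> {x. r * \<phi> x \<noteq> 0}" and "x \<notin> closure {x. \<phi> x \<noteq> 0}"
    then have "\<phi> x = 0" by (intro eq_0_outside_support)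
    with x show False by simp
  qed
qed

lemma test_functions_add:
  assumes "\<phi> \<in> test_functions \<Omega>" "\<psi> \<in> test_functions \<Omega>"
  shows "(\<lambda>x. \<phi> x + \<psi> x) \<in> test_functions \<Omega>"
proof (rule test_functions_supportI)
  let ?K = "closure {x. \<phi> x \<noteq> 0} \<union> closure {x. \<psi> x \<noteq> 0}"
  show "compact ?K" "?K \<subseteq> \<Omega>"
    using test_function_support[OF assms(1)] test_function_support[OF assms(2)] by auto
  show "{x. \<phi> x + \<psi> x \<noteq> 0} \<subseteq> ?K"
  proof (rule subsetI, rule ccontr)
    fix x assume x: "x \<in> {x. \<phi> x + \<psi> x \<noteq> 0}" and "x \<notin> ?K"
    then have "x \<notin> closure {x. \<phi> x \<noteq> 0}" "x \<notin> closure {x. \<psi> x \<noteq> 0}"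
      by (simp_all only: Un_iff de_Morgan_disj simp_thms)
    then have "\<phi> x = 0" "\<psi> x = 0"
      using eq_0_outside_support[of x \<phi>] eq_0_outside_support[of x \<psi>] by (simp_all only: simp_thms)
    with x show False by simp
  qed
  show "C_k k (\<lambda>x. \<phi> x + \<psi> x)" for k
    using assms by (intro C_k_add test_function_C_k)
qed

lemma test_functions_zero: "(\<lambda>x. 0) \<in> test_functions \<Omega>"
  by (simp add: test_functions_def C_k_const)

lemma test_functions_sum:
  assumes "finite I" "\<And>i. i \<in> I \<Longrightarrow> f i \<in> test_functions \<Omega>"
  shows "(\<lambda>x. \<Sum>i\<in>I. f i x) \<in> test_functions \<Omega>"
  using assms by (induction I rule: finite_induct) (auto intro: test_functions_add test_functions_zero)

lemma test_function_eq_0: "\<phi> \<in> test_functions \<Omega> \<Longrightarrow> x \<notin> \<Omega> \<Longrightarrow> \<phi> x = 0"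
  by (rule eq_0_outside_support) (auto simp: test_functions_def)

lemma integrable_continuous_compact_support:
  fixes f :: "'a::euclidean_space \<Rightarrow> real"
  assumes "continuous_on UNIV f" "compact K" "\<And>x. x \<notin> K \<Longrightarrow> f x = 0"
  shows "integrable lborel f"
proof -
  have "integrable lborel (\<lambda>x. indicator K x *\<^sub>R f x)"
    using borel_integrable_compact[OF assms(2) continuous_on_subset[OF assms(1)]] by simp
  moreover have "(\<lambda>x. indicator K x *\<^sub>R f x) = f"
    using assms(3) by (auto simp: fun_eq_iff indicator_def)
  ultimately show ?thesis by simp
qed

lemma test_function_sq_integrable:
  assumes "\<phi> \<in> test_functions \<Omega>"
  shows "sq_integrable \<phi>"
proof -
  have c: "continuous_on UNIV \<phi>" by (rule test_function_continuous[OF assms])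
  have "integrable lborel (\<lambda>x. (norm (\<phi> x))\<^sup>2)"
  proof (rule integrable_continuous_compact_support)
    show "continuous_on UNIV (\<lambda>x. (norm (\<phi> x))\<^sup>2)"
      by (intro continuous_intros c)
    show "compact (closure {x. \<phi> x \<noteq> 0})"
      using assms by (simp add: test_functions_def)
    show "(norm (\<phi> x))\<^sup>2 = 0" if "x \<notin> closure {x. \<phi> x \<noteq> 0}" for x
      using eq_0_outside_support[OF that] by simp
  qed
  moreover have "\<phi> \<in> borel_measurable lborel"
    using borel_measurable_continuous_onI[OF c] by simp
  ultimately show ?thesis by (simp add: sq_integrable_def)
qed

text \<open>
  The integral of \<open>f (x + h e)\<close> does not depend on \<open>h\<close>, by translation invariance;
  differentiate at \<open>h = 0\<close> under the integral sign.
\<close>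

lemma integral_partial_deriv_eq_0:
  fixes f :: "'a::euclidean_space \<Rightarrow> real"
  assumes d: "\<And>x. f differentiable (at x)" and c: "continuous_on UNIV (partial_deriv e f)"
    and K: "compact K" "\<And>x. x \<notin> K \<Longrightarrow> f x = 0" and e: "norm e = 1"
  shows "(\<integral>x. partial_deriv e f x \<partial>lborel) = 0"
proof -
  obtain R where R: "K \<subseteq> cball 0 R"
    using compact_imp_bounded[OF K(1)] by (auto simp: bounded_iff subset_eq)
  have fc: "continuous_on UNIV f"
    using d by (auto simp: continuous_on_eq_continuous_within differentiable_imp_continuous_within)
  have [measurable]: "f \<in> borel_measurable borel" "partial_deriv e f \<in> borel_measurable borel"
    using borel_measurable_continuous_onI fc c by auto
  have fi: "integrable lborel f"
    by (rule integrable_continuous_compact_support[OF fc K])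
  define q where "q n x = real (Suc n) * (f (x + (1 / real (Suc n)) *\<^sub>R e) - f x)" for n x
  have "(\<integral>x. f (x + v) \<partial>lborel) = (\<integral>x. f x \<partial>lborel) \<and> integrable lborel (\<lambda>x. f (x + v))" for v
  proof -
    have "(\<integral>x. f x \<partial>lborel) = (\<integral>x. f x \<partial>distr lborel borel ((+) v))"
      by (simp add: lborel_distr_plus)
    also have "\<dots> = (\<integral>x. f (v + x) \<partial>lborel)"
      by (rule integral_distr) auto
    finally show ?thesis
      using fi integrable_distr_eq[of "(+) v" lborel borel f] lborel_distr_plus[of v]
      by (simp add: add.commute)
  qed
  then have q0: "(\<integral>x. q n x \<partial>lborel) = 0" for n
    unfolding q_def using fi by simp
  have "continuous_on (cball 0 (R + 1)) (partial_deriv e f)"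
    using c continuous_on_subset by blast
  then have "bounded (partial_deriv e f ` cball 0 (R + 1))"
    by (intro compact_imp_bounded compact_continuous_image) auto
  then obtain C where "\<forall>y\<in>partial_deriv e f ` cball 0 (R + 1). norm y \<le> C"
    by (auto simp only: bounded_iff)
  then have C: "\<bar>partial_deriv e f x\<bar> \<le> C" if "x \<in> cball 0 (R + 1)" for x
    using that by simp
  have line: "((\<lambda>t. f (x + t *\<^sub>R e)) has_real_derivative partial_deriv e f (x + t *\<^sub>R e)) (at t)" for x t
  proof -
    interpret D: linear "\<lambda>v. partial_deriv v f (x + t *\<^sub>R e)"
      using has_derivative_partial_deriv[OF d] has_derivative_linear by blast
    have "((\<lambda>t. x + t *\<^sub>R e) has_derivative (\<lambda>r. r *\<^sub>R e)) (at t)"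
      by (auto intro!: derivative_eq_intros)
    from has_derivative_compose[OF this has_derivative_partial_deriv[OF d]]
    have "((\<lambda>t. f (x + t *\<^sub>R e)) has_derivative (\<lambda>r. partial_deriv (r *\<^sub>R e) f (x + t *\<^sub>R e))) (at t)" .
    moreover have "(\<lambda>r. partial_deriv (r *\<^sub>R e) f (x + t *\<^sub>R e)) = (*) (partial_deriv e f (x + t *\<^sub>R e))"
      by (rule ext) (simp add: D.scaleR)
    ultimately show ?thesis
      by (simp add: has_field_derivative_def)
  qed
  have bound: "\<bar>q n x\<bar> \<le> C * indicator (cball 0 (R + 1)) x" for n x
  proof -
    let ?h = "1 / real (Suc n)"
    have h: "0 < ?h" "?h \<le> 1" by auto
    show ?thesis
    proof (cases "x \<in> cball 0 (R + 1)")
      case True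
      obtain t where t: "0 < t" "t < ?h"
          "f (x + ?h *\<^sub>R e) - f (x + 0 *\<^sub>R e) = (?h - 0) * partial_deriv e f (x + t *\<^sub>R e)"
        using MVT2[of 0 ?h "\<lambda>t. f (x + t *\<^sub>R e)" "\<lambda>t. partial_deriv e f (x + t *\<^sub>R e)"] line h(1)
        by auto
      then have q: "q n x = partial_deriv e f (x + t *\<^sub>R e)"
        unfolding q_def by simp
      have "\<bar>partial_deriv e f z\<bar> \<le> C" for z
      proof (cases "z \<in> cball 0 (R + 1)")
        case False
        have "z \<notin> closure {x. f x \<noteq> 0}"
        proof -
          have "closure {x. f x \<noteq> 0} \<subseteq> K"
            using K by (intro closure_minimal compact_imp_closed) auto
          with R have "closure {x. f x \<noteq> 0} \<subseteq> cball 0 (R + 1)"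
            using subset_cball[of R "R + 1" "0::'a"] by simp
          then show ?thesis using False by blast
        qed
        then have "partial_deriv e f z = 0" by (rule partial_deriv_eq_0_outside_support)
        with C[OF True] show ?thesis by simp
      qed (rule C)
      with q True show ?thesis by simp
    next
      case False
      then have "x \<notin> K" using R by (auto simp: subset_eq)
      moreover have "x + ?h *\<^sub>R e \<notin> K"
      proof
        assume "x + ?h *\<^sub>R e \<in> K"
        then have "norm (x + ?h *\<^sub>R e) \<le> R" using R by auto
        moreover have "norm x \<le> norm (x + ?h *\<^sub>R e) + norm (?h *\<^sub>R e)"
          by (metis add_diff_cancel norm_triangle_ineq4)
        moreover have "norm (?h *\<^sub>R e) \<le> 1" using h e by simp
        ultimately have "norm x \<le> R + 1" by linarith
        then show False using False by simp
      qed
      ultimately show ?thesis using K(2) False by (simp add: q_def)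
    qed
  qed
  have lim: "(\<lambda>n. q n x) \<longlonglongrightarrow> partial_deriv e f x" for x
  proof -
    have "filterlim (\<lambda>n. 1 / real (Suc n)) (at 0) sequentially"
      unfolding filterlim_at using LIMSEQ_Suc[OF lim_1_over_n] by simp
    from filterlim_compose[OF line[of x 0, unfolded DERIV_def] this]
    have "(\<lambda>n. (f (x + (1 / real (Suc n)) *\<^sub>R e) - f x) / (1 / real (Suc n)))
        \<longlonglongrightarrow> partial_deriv e f x"
      by simp
    then show ?thesis by (simp add: q_def mult.commute)
  qed
  have "(\<lambda>n. \<integral>x. q n x \<partial>lborel) \<longlonglongrightarrow> (\<integral>x. partial_deriv e f x \<partial>lborel)"
  proof (rule integral_dominated_convergence[where w = "\<lambda>x. C * indicator (cball 0 (R + 1)) x"])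
    show "integrable lborel (\<lambda>x. C * indicator (cball 0 (R + 1)) x)"
      by (intro integrable_mult_right integrable_real_indicator)
        (use emeasure_bounded_finite[OF bounded_cball, of 0 "R + 1"] in auto)
    show "q n \<in> borel_measurable lborel" for n unfolding q_def by measurable
  qed (use bound lim in auto)
  then show ?thesis
    by (simp add: q0 LIMSEQ_const_iff)
qed

lemma integral_by_parts_test_functions:
  assumes \<phi>: "\<phi> \<in> test_functions \<Omega>" and \<psi>: "\<psi> \<in> test_functions \<Omega>" and e: "e \<in> Basis"
  shows "(\<integral>x. \<phi> x * partial_deriv e \<psi> x \<partial>lborel) = - (\<integral>x. partial_deriv e \<phi> x * \<psi> x \<partial>lborel)"
proof -
  note d = test_function_differentiable[OF \<phi>] test_function_differentiable[OF \<psi>]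
  note p = partial_deriv_mult[OF d, of e]
  have "(\<integral>x. partial_deriv e (\<lambda>x. \<phi> x * \<psi> x) x \<partial>lborel) = 0"
  proof (rule integral_partial_deriv_eq_0)
    show "compact (closure {x. \<phi> x \<noteq> 0})" using \<phi> by (simp add: test_functions_def)
    show "continuous_on UNIV (partial_deriv e (\<lambda>x. \<phi> x * \<psi> x))"
      unfolding p
      by (intro continuous_intros test_function_continuous[OF \<phi>] test_function_continuous[OF \<psi>]
          test_function_continuous[OF partial_deriv_test_function[OF \<phi> e]]
          test_function_continuous[OF partial_deriv_test_function[OF \<psi> e]])
    show "\<phi> x * \<psi> x = 0" if "x \<notin> closure {x. \<phi> x \<noteq> 0}" for x
      using eq_0_outside_support[OF that] by simp
  qed (use d e in \<open>auto intro: differentiable_mult\<close>)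
  moreover have "integrable lborel (\<lambda>x. \<phi> x * partial_deriv e \<psi> x)"
      "integrable lborel (\<lambda>x. partial_deriv e \<phi> x * \<psi> x)"
    using sq_integrable_inner[OF test_function_sq_integrable[OF \<phi>]
        test_function_sq_integrable[OF partial_deriv_test_function[OF \<psi> e]]]
      sq_integrable_inner[OF test_function_sq_integrable[OF partial_deriv_test_function[OF \<phi> e]]
        test_function_sq_integrable[OF \<psi>]] by auto
  ultimately show ?thesis unfolding p by simp
qed


section \<open>Square integrable functions and test functions\<close>

lemma l2_rel_refl: "sq_integrable f \<Longrightarrow> l2_rel f f"
  by (simp add: l2_rel_def)

lemma l2_cases:
  obtains f where "sq_integrable f" "u = abs_l2 f"
proof
  show "sq_integrable (rep_l2 u)"
    using Quotient_rep_reflp[OF Quotient_l2, of u] by (simp add: l2_rel_def)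
  show "u = abs_l2 (rep_l2 u)"
    using Quotient_abs_rep[OF Quotient_l2, of u] by simp
qed

lemma abs_l2_eq_iff:
  assumes "sq_integrable f" "sq_integrable g"
  shows "abs_l2 f = abs_l2 g \<longleftrightarrow> (AE x in lborel. f x = g x)"
  using Quotient_rel[OF Quotient_l2, of f g] assms by (auto simp: l2_rel_def)

lemma abs_l2_zero: "abs_l2 (\<lambda>x. 0) = 0"
  by (simp add: zero_l2_def)

lemma abs_l2_add:
  "sq_integrable f \<Longrightarrow> sq_integrable g \<Longrightarrow> abs_l2 (\<lambda>x. f x + g x) = abs_l2 f + abs_l2 g"
  by (simp add: plus_l2.abs_eq l2_rel_refl)

lemma abs_l2_scaleR: "sq_integrable f \<Longrightarrow> abs_l2 (\<lambda>x. r *\<^sub>R f x) = r *\<^sub>R abs_l2 f"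
  by (simp add: scaleR_l2.abs_eq l2_rel_refl)

lemma inner_abs_l2:
  "sq_integrable f \<Longrightarrow> sq_integrable g \<Longrightarrow> abs_l2 f \<bullet> abs_l2 g = (\<integral>x. f x \<bullet> g x \<partial>lborel)"
  by (simp add: inner_l2.abs_eq l2_rel_refl)

lemma l2_component_abs: "sq_integrable f \<Longrightarrow> l2_component e (abs_l2 f) = abs_l2 (\<lambda>x. f x \<bullet> e)"
  by (simp add: l2_component.abs_eq l2_rel_refl)

lemma abs_l2_mem_L2_iff:
  "sq_integrable f \<Longrightarrow> abs_l2 f \<in> L2 \<Omega> \<longleftrightarrow> (AE x in lborel. x \<notin> \<Omega> \<longrightarrow> f x = 0)"
  by (simp add: L2_def vanishes_outside.abs_eq l2_rel_refl)

lemma L2_zero: "0 \<in> L2 \<Omega>"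
  using abs_l2_mem_L2_iff[OF sq_integrable_zero, of \<Omega>] by (simp add: abs_l2_zero)

lemma L2_add:
  assumes "u \<in> L2 \<Omega>" "v \<in> L2 \<Omega>"
  shows "u + v \<in> L2 \<Omega>"
proof -
  obtain f g where "sq_integrable f" "u = abs_l2 f" "sq_integrable g" "v = abs_l2 g"
    by (meson l2_cases)
  with assms show ?thesis
    by (simp add: abs_l2_add[symmetric] abs_l2_mem_L2_iff sq_integrable_add) (auto elim: AE_mp)
qed

lemma L2_scaleR:
  assumes "u \<in> L2 \<Omega>"
  shows "r *\<^sub>R u \<in> L2 \<Omega>"
proof -
  obtain f where "sq_integrable f" "u = abs_l2 f" by (meson l2_cases)
  with assms show ?thesis
    by (simp add: abs_l2_scaleR[symmetric] abs_l2_mem_L2_iff sq_integrable_scaleR) (auto elim: AE_mp)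
qed

lemma L2_diff: "u \<in> L2 \<Omega> \<Longrightarrow> v \<in> L2 \<Omega> \<Longrightarrow> u - v \<in> L2 \<Omega>"
  using L2_add[of u \<Omega> "(-1) *\<^sub>R v"] L2_scaleR[of v \<Omega> "-1"] by simp

lemma L2_sum: "(\<And>i. i \<in> I \<Longrightarrow> f i \<in> L2 \<Omega>) \<Longrightarrow> (\<Sum>i\<in>I. f i) \<in> L2 \<Omega>"
  by (induction I rule: infinite_finite_induct) (auto intro: L2_zero L2_add)

lemma l2_component_add: "l2_component e (F + G) = l2_component e F + l2_component e G"
proof -
  obtain f g where "sq_integrable f" "F = abs_l2 f" "sq_integrable g" "G = abs_l2 g"
    by (meson l2_cases)
  then show ?thesis
    by (simp add: abs_l2_add[symmetric] l2_component_abs sq_integrable_add sq_integrable_component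
        inner_add_left)
qed

lemma l2_component_scaleR: "l2_component e (r *\<^sub>R F) = r *\<^sub>R l2_component e F"
proof -
  obtain f where "sq_integrable f" "F = abs_l2 f" by (meson l2_cases)
  then show ?thesis
    using abs_l2_scaleR[OF sq_integrable_component, of f r e]
    by (simp add: abs_l2_scaleR[symmetric] l2_component_abs sq_integrable_scaleR)
qed

lemma l2_component_mem_L2:
  assumes "F \<in> L2 \<Omega>"
  shows "l2_component e F \<in> L2 \<Omega>"
proof -
  obtain f where "sq_integrable f" "F = abs_l2 f" by (meson l2_cases)
  with assms show ?thesis
    by (simp add: l2_component_abs abs_l2_mem_L2_iff sq_integrable_component) (auto elim: AE_mp)
qed

lemma l2_component_eqI:
  assumes "\<And>e. e \<in> Basis \<Longrightarrow> l2_component e F = l2_component e G"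
  shows "F = G"
proof -
  obtain f g where fg: "sq_integrable f" "F = abs_l2 f" "sq_integrable g" "G = abs_l2 g"
    by (meson l2_cases)
  have "AE x in lborel. \<forall>e\<in>Basis. f x \<bullet> e = g x \<bullet> e"
    using assms fg
    by (intro AE_finite_allI) (auto simp: l2_component_abs abs_l2_eq_iff sq_integrable_component)
  then have "AE x in lborel. f x = g x"
    by (rule AE_mp) (auto intro: euclidean_eqI)
  then show ?thesis using fg by (simp add: abs_l2_eq_iff)
qed

lemma sq_integrable_times_vector:
  fixes f :: "'a::euclidean_space \<Rightarrow> real" and v :: "'b::euclidean_space"
  assumes "sq_integrable f"
  shows "sq_integrable (\<lambda>x. f x *\<^sub>R v)"
  using assms by (auto simp: sq_integrable_def power_mult_distrib)

lemma sq_integrable_sum: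
  assumes "\<And>i. i \<in> I \<Longrightarrow> sq_integrable (f i)"
  shows "sq_integrable (\<lambda>x. \<Sum>i\<in>I. f i x)"
  using assms
  by (induction I rule: infinite_finite_induct) (auto intro: sq_integrable_zero sq_integrable_add)

lemma abs_l2_sum:
  assumes "\<And>i. i \<in> I \<Longrightarrow> sq_integrable (f i)"
  shows "abs_l2 (\<lambda>x. \<Sum>i\<in>I. f i x) = (\<Sum>i\<in>I. abs_l2 (f i))"
  using assms
  by (induction I rule: infinite_finite_induct) (auto simp: abs_l2_zero abs_l2_add sq_integrable_sum)

lemma inner_l2_components:
  "F \<bullet> G = (\<Sum>e\<in>Basis. l2_component e F \<bullet> l2_component e G)"
proof -
  obtain f g where fg: "sq_integrable f" "F = abs_l2 f" "sq_integrable g" "G = abs_l2 g"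
    by (meson l2_cases)
  then have "(\<Sum>e\<in>Basis. l2_component e F \<bullet> l2_component e G) = (\<Sum>e\<in>Basis. \<integral>x. (f x \<bullet> e) * (g x \<bullet> e) \<partial>lborel)"
    by (simp add: l2_component_abs inner_abs_l2 sq_integrable_component)
  also have "\<dots> = (\<integral>x. (\<Sum>e\<in>Basis. (f x \<bullet> e) * (g x \<bullet> e)) \<partial>lborel)"
    using sq_integrable_inner[OF sq_integrable_component[OF fg(1)] sq_integrable_component[OF fg(3)]]
    by (subst Bochner_Integration.integral_sum) auto
  also have "\<dots> = F \<bullet> G"
    using fg by (simp add: inner_abs_l2 euclidean_inner[symmetric])
  finally show ?thesis by simp
qed

lemma gradient_sq_integrable:
  assumes "\<phi> \<in> test_functions \<Omega>"
  shows "sq_integrable (gradient \<phi>)"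
  unfolding gradient_def
  by (intro sq_integrable_sum sq_integrable_times_vector
      test_function_sq_integrable[OF partial_deriv_test_function[OF assms]])

lemma gradient_component: "e \<in> Basis \<Longrightarrow> gradient f x \<bullet> e = partial_deriv e f x"
  by (simp add: gradient_def inner_sum_left inner_Basis if_distrib sum.delta cong: if_cong)

lemma l2_component_gradient:
  assumes "\<phi> \<in> test_functions \<Omega>" "e \<in> Basis"
  shows "l2_component e (abs_l2 (gradient \<phi>)) = abs_l2 (partial_deriv e \<phi>)"
  using assms by (simp add: l2_component_abs gradient_sq_integrable gradient_component)

lemma test_function_mem_L2: "\<phi> \<in> test_functions \<Omega> \<Longrightarrow> abs_l2 \<phi> \<in> L2 \<Omega>"
  by (simp add: abs_l2_mem_L2_iff test_function_sq_integrable test_function_eq_0)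

lemma gradient_test_function_mem_L2:
  assumes "\<phi> \<in> test_functions \<Omega>"
  shows "abs_l2 (gradient \<phi>) \<in> L2 \<Omega>"
proof -
  have "gradient \<phi> x = 0" if "x \<notin> \<Omega>" for x
    using that test_function_eq_0[OF partial_deriv_test_function[OF assms]] by (simp add: gradient_def)
  then show ?thesis by (simp add: abs_l2_mem_L2_iff gradient_sq_integrable[OF assms])
qed


section \<open>The fundamental lemma of the calculus of variations\<close>

text \<open>
  Boxes form an intersection-stable generator of the Borel sets, so by Dynkin's lemma the
  integral over every Borel set vanishes. The integral over the whole space is a separate
  assumption because the induction has to pass to complements.
\<close>

lemma AE_eq_0_if_box_integrals_eq_0:
  fixes f :: "'a::euclidean_space \<Rightarrow> real"
  assumes f: "integrable lborel f" and total: "(\<integral>x. f x \<partial>lborel) = 0"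
    and boxes: "\<And>l u. (\<integral>x\<in>box l u. f x \<partial>lborel) = 0"
  shows "AE x in lborel. f x = 0"
proof (rule density_unique_real[OF f])
  fix A :: "'a set"
  assume "A \<in> sets lborel"
  then have A: "A \<in> sigma_sets UNIV (range (\<lambda>(l, u). box l u))"
    by (simp add: borel_eq_box)
  have si: "set_integrable lborel B f" if "B \<in> sets lborel" for B
    using integrable_mult_indicator[OF that f] by (simp add: set_integrable_def)
  have "Int_stable (range (\<lambda>(l, u). box l (u::'a)))"
    by (auto simp: Int_stable_def box_Int_box)
  moreover have "range (\<lambda>(l, u). box l (u::'a)) \<subseteq> Pow UNIV" by simp
  ultimately have "(\<integral>x\<in>A. f x \<partial>lborel) = 0"
    using A
  proof (induction rule: sigma_sets_induct_disjoint)
    case (basic A)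
    then show ?case using boxes by auto
  next
    case empty
    show ?case by (simp add: set_lebesgue_integral_def)
  next
    case (compl A)
    then have A: "A \<in> sets lborel" by (simp add: borel_eq_box)
    have "(\<integral>x\<in>UNIV. f x \<partial>lborel) = (\<integral>x\<in>A. f x \<partial>lborel) + (\<integral>x\<in>UNIV - A. f x \<partial>lborel)"
      using set_integral_Un[of A "UNIV - A" lborel f] A si by simp
    with compl total show ?case by (simp add: set_lebesgue_integral_def)
  next
    case (union A)
    then have A: "A i \<in> sets lborel" for i by (auto simp: borel_eq_box)
    have "(\<integral>x\<in>(\<Union>i. A i). f x \<partial>lborel) = (\<Sum>i. \<integral>x\<in>A i. f x \<partial>lborel)"
      using union(1) A
      by (intro lebesgue_integral_countable_add si sets.countable_UN) (auto simp: disjoint_family_on_def)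
    with union show ?case by simp
  qed
  then show "(\<integral>x\<in>A. f x \<partial>lborel) = (\<integral>x\<in>A. 0 \<partial>lborel)" by simp
qed simp

lemma sq_integrable_indicator_box: "sq_integrable (indicator (box l u) :: _ \<Rightarrow> real)"
proof -
  have "(\<lambda>x. (norm (indicator (box l u) x :: real))\<^sup>2) = indicator (box l u)"
    by (auto simp: fun_eq_iff indicator_def)
  then show ?thesis
    using emeasure_bounded_finite[OF bounded_box, of l u]
    by (auto simp: sq_integrable_def intro!: integrable_real_indicator)
qed

lemma integral_box_eq_0_if_orthogonal_to_bumps:
  fixes f :: "'a::euclidean_space \<Rightarrow> real"
  assumes f: "sq_integrable f" and orth: "\<And>\<phi>. \<phi> \<in> test_functions \<Omega> \<Longrightarrow> (\<integral>x. f x * \<phi> x \<partial>lborel) = 0"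
    and "cbox l u \<subseteq> \<Omega>"
  shows "(\<integral>x. f x * indicator (box l u) x \<partial>lborel) = 0"
proof -
  let ?\<phi> = "\<lambda>n. box_bump (1 / real (Suc n)) l u"
  have test: "?\<phi> n \<in> test_functions \<Omega>" for n
    using assms(3) by (intro box_bump_test_function) auto
  have [measurable]: "f \<in> borel_measurable borel"
    using f by (simp add: sq_integrable_def)
  from sq_integrable_inner[OF f sq_integrable_indicator_box]
  have i: "integrable lborel (\<lambda>x. f x * indicator (box l u) x)" by simp
  have "(\<lambda>n. \<integral>x. f x * ?\<phi> n x \<partial>lborel) \<longlonglongrightarrow> (\<integral>x. f x * indicator (box l u) x \<partial>lborel)"
  proof (rule integral_dominated_convergence[where w = "\<lambda>x. norm (f x * indicator (box l u) x)"])
    show "(\<lambda>x. f x * ?\<phi> n x) \<in> borel_measurable lborel" for n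
      using borel_measurable_continuous_onI[OF test_function_continuous[OF test]] by measurable
    show "AE x in lborel. norm (f x * ?\<phi> n x) \<le> norm (f x * indicator (box l u) x)" for n
    proof (rule AE_I2)
      fix x
      have "norm (?\<phi> n x) \<le> indicator (box l u) x"
        using box_bump_pos_iff[of "1 / real (Suc n)" l u x] box_bump_bounds[of "1 / real (Suc n)" l u x]
        by (cases "x \<in> box l u") auto
      then show "norm (f x * ?\<phi> n x) \<le> norm (f x * indicator (box l u) x)"
        by (simp add: abs_mult mult_left_mono)
    qed
    show "AE x in lborel. (\<lambda>n. f x * ?\<phi> n x) \<longlonglongrightarrow> f x * indicator (box l u) x"
      by (intro AE_I2 tendsto_mult tendsto_const box_bump_tendsto_indicator)
  qed (use i in auto)
  then have "(\<lambda>n. 0) \<longlonglongrightarrow> (\<integral>x. f x * indicator (box l u) x \<partial>lborel)"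
    by (simp only: orth[OF test])
  then show ?thesis by (simp add: LIMSEQ_const_iff)
qed

text \<open>
  A countable family of boxes with closure in \<open>\<Omega>\<close> covers \<open>\<Omega>\<close>, and on each of them \<open>u\<close> vanishes
  almost everywhere: the intersection of two such boxes is one again, and its indicator
  function is a limit of test functions.
\<close>

lemma L2_eq_0_if_orthogonal_to_test_functions:
  fixes u :: "('a::euclidean_space, real) l2"
  assumes "open \<Omega>" "u \<in> L2 \<Omega>" "\<And>\<phi>. \<phi> \<in> test_functions \<Omega> \<Longrightarrow> u \<bullet> abs_l2 \<phi> = 0"
  shows "u = 0"
proof -
  obtain f where f: "sq_integrable f" "u = abs_l2 f" by (rule l2_cases)
  have orth: "(\<integral>x. f x * \<phi> x \<partial>lborel) = 0" if "\<phi> \<in> test_functions \<Omega>" for \<phi>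
    using assms(3)[OF that] f test_function_sq_integrable[OF that] by (simp add: inner_abs_l2)
  have on_box: "AE x in lborel. x \<in> box l r \<longrightarrow> f x = 0" if "cbox l r \<subseteq> \<Omega>" for l r
  proof -
    let ?g = "\<lambda>x. f x * indicator (box l r) x"
  from sq_integrable_inner[OF f(1) sq_integrable_indicator_box]
    have i: "integrable lborel ?g" by simp
    have "AE x in lborel. ?g x = 0"
    proof (rule AE_eq_0_if_box_integrals_eq_0[OF i])
      show "(\<integral>x. ?g x \<partial>lborel) = 0"
        by (rule integral_box_eq_0_if_orthogonal_to_bumps[OF f(1) orth that])
      show "(\<integral>x\<in>box l' r'. ?g x \<partial>lborel) = 0" for l' r'
      proof -
        obtain p q where pq: "box l r \<inter> box l' r' = box p q" "cbox l r \<inter> cbox l' r' = cbox p q"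
          by (simp add: Int_interval box_Int_box)
        then have "cbox p q \<subseteq> \<Omega>" using that by auto
        from integral_box_eq_0_if_orthogonal_to_bumps[OF f(1) orth this]
        show ?thesis
          by (simp add: set_lebesgue_integral_def pq(1)[symmetric] indicator_inter_arith mult_ac)
      qed
    qed
    then show ?thesis by (rule AE_mp) (auto simp: indicator_def)
  qed
  have "AE x in lborel. x \<in> \<Omega> \<longrightarrow> f x = 0"
  proof -
    define F where "F = {box l r | l r :: 'a. cbox l r \<subseteq> \<Omega>}"
    have "\<And>B. B \<in> F \<Longrightarrow> open B" by (auto simp: F_def)
    then obtain F' where F': "F' \<subseteq> F" "countable F'" "\<Union>F' = \<Union>F"
      by (rule Lindelof)
    have "\<Omega> \<subseteq> \<Union>F"
    proof
      fix x assume "x \<in> \<Omega>"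
      then obtain l r where "x \<in> box l r" "cbox l r \<subseteq> \<Omega>"
        using open_contains_cbox[OF assms(1)] by metis
      then show "x \<in> \<Union>F" by (auto simp: F_def)
    qed
    have "AE x in lborel. \<forall>B\<in>F'. x \<in> B \<longrightarrow> f x = 0"
      using F'(1) on_box by (subst AE_ball_countable[OF F'(2)]) (auto simp: F_def)
    then show ?thesis
    proof (rule AE_mp, intro AE_I2 impI)
      fix x assume "\<forall>B\<in>F'. x \<in> B \<longrightarrow> f x = 0" "x \<in> \<Omega>"
      with \<open>\<Omega> \<subseteq> \<Union>F\<close> F'(3) show "f x = 0" by blast
    qed
  qed
  moreover have "AE x in lborel. x \<notin> \<Omega> \<longrightarrow> f x = 0"
    using assms(2) f by (simp add: abs_l2_mem_L2_iff)
  ultimately have "AE x in lborel. f x = 0" by eventually_elim blast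
  then show ?thesis
    using f abs_l2_eq_iff[OF f(1) sq_integrable_zero] by (simp add: abs_l2_zero)
qed


section \<open>Weak derivatives\<close>

lemma L2_eqI_test_functions:
  fixes u v :: "('a::euclidean_space, real) l2"
  assumes "open \<Omega>" "u \<in> L2 \<Omega>" "v \<in> L2 \<Omega>"
    and "\<And>\<phi>. \<phi> \<in> test_functions \<Omega> \<Longrightarrow> u \<bullet> abs_l2 \<phi> = v \<bullet> abs_l2 \<phi>"
  shows "u = v"
  using L2_eq_0_if_orthogonal_to_test_functions[OF assms(1) L2_diff[OF assms(2,3)]] assms(4)
  by (simp add: inner_diff_left)

lemma weak_gradient_eqI:
  assumes "open \<Omega>" "G \<in> L2 \<Omega>" "has_weak_gradient \<Omega> u G"
  shows "weak_gradient \<Omega> u = G"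
  unfolding weak_gradient_def
proof (rule the_equality)
  fix G' assume G': "G' \<in> L2 \<Omega> \<and> has_weak_gradient \<Omega> u G'"
  show "G' = G"
  proof (rule l2_component_eqI)
    fix e :: 'a assume "e \<in> Basis"
    then show "l2_component e G' = l2_component e G"
      using G' assms
      by (intro L2_eqI_test_functions[OF assms(1)] l2_component_mem_L2)
        (auto simp: has_weak_gradient_def has_weak_partial_def)
  qed
qed (use assms in auto)

lemma weak_gradient:
  assumes "open \<Omega>" "u \<in> H1 \<Omega>"
  shows "weak_gradient \<Omega> u \<in> L2 \<Omega>" "has_weak_gradient \<Omega> u (weak_gradient \<Omega> u)"
proof -
  obtain G where "G \<in> L2 \<Omega>" "has_weak_gradient \<Omega> u G"
    using assms(2) by (auto simp: H1_def)
  with weak_gradient_eqI[OF assms(1) this]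
  show "weak_gradient \<Omega> u \<in> L2 \<Omega>" "has_weak_gradient \<Omega> u (weak_gradient \<Omega> u)" by auto
qed

lemma has_weak_gradient_add:
  "has_weak_gradient \<Omega> u F \<Longrightarrow> has_weak_gradient \<Omega> v G \<Longrightarrow> has_weak_gradient \<Omega> (u + v) (F + G)"
  by (simp add: has_weak_gradient_def has_weak_partial_def l2_component_add inner_add_left)

lemma has_weak_gradient_scaleR:
  "has_weak_gradient \<Omega> u F \<Longrightarrow> has_weak_gradient \<Omega> (r *\<^sub>R u) (r *\<^sub>R F)"
  by (simp add: has_weak_gradient_def has_weak_partial_def l2_component_scaleR)

lemma H1_add:
  assumes "open \<Omega>" "u \<in> H1 \<Omega>" "v \<in> H1 \<Omega>"
  shows "u + v \<in> H1 \<Omega>" "weak_gradient \<Omega> (u + v) = weak_gradient \<Omega> u + weak_gradient \<Omega> v"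
proof -
  note G = has_weak_gradient_add[OF weak_gradient(2)[OF assms(1,2)] weak_gradient(2)[OF assms(1,3)]]
  note L = L2_add[OF weak_gradient(1)[OF assms(1,2)] weak_gradient(1)[OF assms(1,3)]]
  show "weak_gradient \<Omega> (u + v) = weak_gradient \<Omega> u + weak_gradient \<Omega> v"
    by (rule weak_gradient_eqI[OF assms(1) L G])
  show "u + v \<in> H1 \<Omega>"
    using assms G L by (auto simp: H1_def intro: L2_add)
qed

lemma H1_scaleR:
  assumes "open \<Omega>" "u \<in> H1 \<Omega>"
  shows "r *\<^sub>R u \<in> H1 \<Omega>" "weak_gradient \<Omega> (r *\<^sub>R u) = r *\<^sub>R weak_gradient \<Omega> u"
proof -
  note G = has_weak_gradient_scaleR[OF weak_gradient(2)[OF assms], of r]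
  note L = L2_scaleR[OF weak_gradient(1)[OF assms], of r]
  show "weak_gradient \<Omega> (r *\<^sub>R u) = r *\<^sub>R weak_gradient \<Omega> u"
    by (rule weak_gradient_eqI[OF assms(1) L G])
  show "r *\<^sub>R u \<in> H1 \<Omega>"
    using assms G L by (auto simp: H1_def intro: L2_scaleR)
qed

lemma weak_div_eqI:
  assumes "open \<Omega>" "w \<in> L2 \<Omega>" "has_weak_div \<Omega> F w"
  shows "weak_div \<Omega> F = w"
  unfolding weak_div_def
proof (rule the_equality)
  fix w' assume "w' \<in> L2 \<Omega> \<and> has_weak_div \<Omega> F w'"
  then show "w' = w"
    using assms by (intro L2_eqI_test_functions[OF assms(1)]) (auto simp: has_weak_div_def)
qed (use assms in auto)

lemma weak_div:
  assumes "open \<Omega>" "\<exists>w\<in>L2 \<Omega>. has_weak_div \<Omega> F w"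
  shows "weak_div \<Omega> F \<in> L2 \<Omega>" "has_weak_div \<Omega> F (weak_div \<Omega> F)"
  using assms weak_div_eqI by metis+

lemma weak_div_zero: "open \<Omega> \<Longrightarrow> weak_div \<Omega> 0 = 0"
  by (rule weak_div_eqI) (auto simp: L2_zero has_weak_div_def)

text \<open>
  Weak divergences of general fields need not exist, and \<open>weak_laplacian\<close> is unspecified when
  they do not. On \<open>H2\<close>, the weak Laplacian is the trace of the matrix of second weak
  derivatives.
\<close>

lemma weak_laplacian:
  assumes "open \<Omega>" "y \<in> H2 \<Omega>"
  shows "weak_laplacian \<Omega> y \<in> L2 \<Omega>" "has_weak_div \<Omega> (weak_gradient \<Omega> y) (weak_laplacian \<Omega> y)"
proof -
  let ?G = "weak_gradient \<Omega> y"
  let ?d = "\<lambda>e. l2_component e (weak_gradient \<Omega> (l2_component e ?G))"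
  have h: "l2_component e ?G \<in> H1 \<Omega>" if "e \<in> Basis" for e
    using assms(2) that by (simp add: H2_def)
  have "?d e \<in> L2 \<Omega>" if "e \<in> Basis" for e
    by (intro l2_component_mem_L2 weak_gradient(1)[OF assms(1)] h that)
  then have "(\<Sum>e\<in>Basis. ?d e) \<in> L2 \<Omega>" by (rule L2_sum)
  moreover have "has_weak_div \<Omega> ?G (\<Sum>e\<in>Basis. ?d e)"
    unfolding has_weak_div_def
  proof
    fix \<phi> assume \<phi>: "\<phi> \<in> test_functions \<Omega>"
    have "l2_component e ?G \<bullet> abs_l2 (partial_deriv e \<phi>) = - (?d e \<bullet> abs_l2 \<phi>)" if "e \<in> Basis" for e
      using weak_gradient(2)[OF assms(1) h[OF that]] that \<phi>
      by (simp add: has_weak_gradient_def has_weak_partial_def)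
    then show "?G \<bullet> abs_l2 (gradient \<phi>) = - ((\<Sum>e\<in>Basis. ?d e) \<bullet> abs_l2 \<phi>)"
      by (subst inner_l2_components) (simp add: l2_component_gradient[OF \<phi>] inner_sum_left sum_negf)
  qed
  ultimately show "weak_laplacian \<Omega> y \<in> L2 \<Omega>" "has_weak_div \<Omega> ?G (weak_laplacian \<Omega> y)"
    unfolding weak_laplacian_def using weak_div[OF assms(1), of ?G] by blast+
qed


section \<open>The space of functions vanishing on the boundary\<close>

lemma test_function_has_weak_gradient:
  assumes "\<phi> \<in> test_functions \<Omega>"
  shows "has_weak_gradient \<Omega> (abs_l2 \<phi>) (abs_l2 (gradient \<phi>))"
  unfolding has_weak_gradient_def has_weak_partial_def
proof (intro ballI)
  fix e :: 'a and \<psi> assume e: "e \<in> Basis" and \<psi>: "\<psi> \<in> test_functions \<Omega>"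
  show "abs_l2 \<phi> \<bullet> abs_l2 (partial_deriv e \<psi>) = - (l2_component e (abs_l2 (gradient \<phi>)) \<bullet> abs_l2 \<psi>)"
    using integral_by_parts_test_functions[OF assms \<psi> e]
    by (simp add: l2_component_gradient[OF assms e] inner_abs_l2 test_function_sq_integrable[OF assms]
        test_function_sq_integrable[OF \<psi>] test_function_sq_integrable[OF partial_deriv_test_function[OF assms e]]
        test_function_sq_integrable[OF partial_deriv_test_function[OF \<psi> e]])
qed

lemma weak_gradient_test_function:
  assumes "open \<Omega>" "\<phi> \<in> test_functions \<Omega>"
  shows "weak_gradient \<Omega> (abs_l2 \<phi>) = abs_l2 (gradient \<phi>)"
  by (rule weak_gradient_eqI[OF assms(1) gradient_test_function_mem_L2[OF assms(2)]
        test_function_has_weak_gradient[OF assms(2)]])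

lemma test_function_mem_H1: "\<phi> \<in> test_functions \<Omega> \<Longrightarrow> abs_l2 \<phi> \<in> H1 \<Omega>"
  using test_function_has_weak_gradient gradient_test_function_mem_L2 test_function_mem_L2
  by (fastforce simp: H1_def)

text \<open>
  Read as a distance in a product of inner product spaces, the approximation condition
  is accessible to the triangle inequality.
\<close>

lemma H1_0_iff:
  "u \<in> H1_0 \<Omega> \<longleftrightarrow> u \<in> H1 \<Omega> \<and> (\<forall>\<delta>>0. \<exists>\<phi>\<in>test_functions \<Omega>.
    norm ((u, weak_gradient \<Omega> u) - (abs_l2 \<phi>, abs_l2 (gradient \<phi>))) < \<delta>)"
  by (simp add: H1_0_def norm_Pair)

lemma test_function_mem_H1_0:
  assumes "open \<Omega>" "\<phi> \<in> test_functions \<Omega>"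
  shows "abs_l2 \<phi> \<in> H1_0 \<Omega>"
  unfolding H1_0_iff
proof (intro conjI allI impI)
  fix \<delta> :: real assume "\<delta> > 0"
  then show "\<exists>\<psi>\<in>test_functions \<Omega>.
      norm ((abs_l2 \<phi>, weak_gradient \<Omega> (abs_l2 \<phi>)) - (abs_l2 \<psi>, abs_l2 (gradient \<psi>))) < \<delta>"
    by (intro bexI[OF _ assms(2)]) (simp add: weak_gradient_test_function[OF assms])
qed (rule test_function_mem_H1[OF assms(2)])

lemma gradient_add:
  assumes "\<phi> \<in> test_functions \<Omega>" "\<psi> \<in> test_functions \<Omega>"
  shows "gradient (\<lambda>x. \<phi> x + \<psi> x) = (\<lambda>x. gradient \<phi> x + gradient \<psi> x)"
  by (rule ext) (simp add: gradient_def partial_deriv_add[OF test_function_differentiable[OF assms(1)]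
        test_function_differentiable[OF assms(2)]] scaleR_add_left sum.distrib)

lemma gradient_cmult:
  assumes "\<phi> \<in> test_functions \<Omega>"
  shows "gradient (\<lambda>x. r * \<phi> x) = (\<lambda>x. r *\<^sub>R gradient \<phi> x)"
  by (rule ext) (simp add: gradient_def partial_deriv_cmult[OF test_function_differentiable[OF assms]]
        scaleR_sum_right)

lemma H1_0_subset_H1: "u \<in> H1_0 \<Omega> \<Longrightarrow> u \<in> H1 \<Omega>"
  by (simp add: H1_0_def)

lemma H1_0_add:
  assumes "open \<Omega>" "u \<in> H1_0 \<Omega>" "v \<in> H1_0 \<Omega>"
  shows "u + v \<in> H1_0 \<Omega>"
  unfolding H1_0_iff
proof (intro conjI allI impI)
  note h = H1_0_subset_H1[OF assms(2)] H1_0_subset_H1[OF assms(3)]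
  show "u + v \<in> H1 \<Omega>" by (rule H1_add(1)[OF assms(1) h])
  fix \<delta> :: real assume "\<delta> > 0"
  then have "\<delta> / 2 > 0" by simp
  then obtain \<phi> \<psi> where \<phi>: "\<phi> \<in> test_functions \<Omega>" and \<psi>: "\<psi> \<in> test_functions \<Omega>"
      and b: "norm ((u, weak_gradient \<Omega> u) - (abs_l2 \<phi>, abs_l2 (gradient \<phi>))) < \<delta> / 2"
        "norm ((v, weak_gradient \<Omega> v) - (abs_l2 \<psi>, abs_l2 (gradient \<psi>))) < \<delta> / 2"
    using assms(2,3) unfolding H1_0_iff by meson
  let ?\<eta> = "\<lambda>x. \<phi> x + \<psi> x"
  have eq: "(u + v, weak_gradient \<Omega> (u + v)) - (abs_l2 ?\<eta>, abs_l2 (gradient ?\<eta>)) =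
      ((u, weak_gradient \<Omega> u) - (abs_l2 \<phi>, abs_l2 (gradient \<phi>))) +
      ((v, weak_gradient \<Omega> v) - (abs_l2 \<psi>, abs_l2 (gradient \<psi>)))"
    using \<phi> \<psi>
    by (simp add: H1_add(2)[OF assms(1) h] gradient_add[OF \<phi> \<psi>] abs_l2_add
        test_function_sq_integrable gradient_sq_integrable)
  have "norm ((u + v, weak_gradient \<Omega> (u + v)) - (abs_l2 ?\<eta>, abs_l2 (gradient ?\<eta>))) < \<delta>"
    unfolding eq using norm_triangle_lt[of _ _ \<delta>] b by (smt (verit) field_sum_of_halves)
  then show "\<exists>\<eta>\<in>test_functions \<Omega>.
      norm ((u + v, weak_gradient \<Omega> (u + v)) - (abs_l2 \<eta>, abs_l2 (gradient \<eta>))) < \<delta>"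
    using test_functions_add[OF \<phi> \<psi>] by blast
qed

lemma H1_0_scaleR:
  assumes "open \<Omega>" "u \<in> H1_0 \<Omega>"
  shows "r *\<^sub>R u \<in> H1_0 \<Omega>"
  unfolding H1_0_iff
proof (intro conjI allI impI)
  note h = H1_0_subset_H1[OF assms(2)]
  show "r *\<^sub>R u \<in> H1 \<Omega>" by (rule H1_scaleR(1)[OF assms(1) h])
  fix \<delta> :: real assume \<delta>: "\<delta> > 0"
  then have "\<delta> / (\<bar>r\<bar> + 1) > 0" by simp
  then obtain \<phi> where \<phi>: "\<phi> \<in> test_functions \<Omega>"
      and b: "norm ((u, weak_gradient \<Omega> u) - (abs_l2 \<phi>, abs_l2 (gradient \<phi>))) < \<delta> / (\<bar>r\<bar> + 1)"
    using assms(2) unfolding H1_0_iff by meson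
  let ?\<eta> = "\<lambda>x. r * \<phi> x"
  have "abs_l2 ?\<eta> = r *\<^sub>R abs_l2 \<phi>"
    using abs_l2_scaleR[OF test_function_sq_integrable[OF \<phi>], of r] by simp
  then have eq: "(r *\<^sub>R u, weak_gradient \<Omega> (r *\<^sub>R u)) - (abs_l2 ?\<eta>, abs_l2 (gradient ?\<eta>)) =
      r *\<^sub>R ((u, weak_gradient \<Omega> u) - (abs_l2 \<phi>, abs_l2 (gradient \<phi>)))"
    using \<phi>
    by (simp add: H1_scaleR(2)[OF assms(1) h] gradient_cmult[OF \<phi>] abs_l2_scaleR
        gradient_sq_integrable scaleR_diff_right)
  have "norm ((r *\<^sub>R u, weak_gradient \<Omega> (r *\<^sub>R u)) - (abs_l2 ?\<eta>, abs_l2 (gradient ?\<eta>)))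
      \<le> (\<bar>r\<bar>) * (\<delta> / (\<bar>r\<bar> + 1))"
    unfolding eq norm_scaleR using b by (intro mult_left_mono) auto
  also have "\<dots> < \<delta>" using \<delta> by (simp add: field_simps)
  finally show "\<exists>\<eta>\<in>test_functions \<Omega>.
      norm ((r *\<^sub>R u, weak_gradient \<Omega> (r *\<^sub>R u)) - (abs_l2 \<eta>, abs_l2 (gradient \<eta>))) < \<delta>"
    using test_functions_cmult[OF \<phi>] by blast
qed

text \<open>
  For a test function in place of \<open>v\<close> this is the definition of the weak divergence. Both sides
  are continuous in \<open>v\<close> with respect to the norm of \<open>H1\<close>, in which test functions approximate
  every element of \<open>H1_0\<close>.
\<close>

lemma Green_formula:
  assumes "has_weak_div \<Omega> F w" "v \<in> H1_0 \<Omega>"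
  shows "F \<bullet> weak_gradient \<Omega> v = - (w \<bullet> v)"
proof -
  have "\<bar>F \<bullet> weak_gradient \<Omega> v + w \<bullet> v\<bar> \<le> \<delta> * norm (w, F)" if \<delta>: "\<delta> > 0" for \<delta>
  proof -
    obtain \<phi> where \<phi>: "\<phi> \<in> test_functions \<Omega>"
        and b: "norm ((v, weak_gradient \<Omega> v) - (abs_l2 \<phi>, abs_l2 (gradient \<phi>))) < \<delta>"
      using assms(2) \<delta> unfolding H1_0_iff by meson
    have "F \<bullet> weak_gradient \<Omega> v + w \<bullet> v =
        ((v, weak_gradient \<Omega> v) - (abs_l2 \<phi>, abs_l2 (gradient \<phi>))) \<bullet> (w, F)"
      using assms(1) \<phi> by (simp add: has_weak_div_def inner_diff_right inner_commute)
    also have "\<bar>\<dots>\<bar> \<le> norm ((v, weak_gradient \<Omega> v) - (abs_l2 \<phi>, abs_l2 (gradient \<phi>))) * norm (w, F)"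
      by (rule Cauchy_Schwarz_ineq2)
    also have "\<dots> \<le> \<delta> * norm (w, F)"
      using b by (intro mult_right_mono) auto
    finally show ?thesis .
  qed
  note bound = this
  have "\<bar>F \<bullet> weak_gradient \<Omega> v + w \<bullet> v\<bar> \<le> 0"
  proof (rule field_le_epsilon)
    fix \<epsilon> :: real assume \<epsilon>: "\<epsilon> > 0"
    have n: "0 < norm (w, F) + 1" by (simp add: add_nonneg_pos)
    have "\<bar>F \<bullet> weak_gradient \<Omega> v + w \<bullet> v\<bar> \<le> \<epsilon> / (norm (w, F) + 1) * norm (w, F)"
      using bound[of "\<epsilon> / (norm (w, F) + 1)"] \<epsilon> n by simp
    also have "\<dots> \<le> 0 + \<epsilon>" using \<epsilon> n by (simp add: field_simps)
    finally show "\<bar>F \<bullet> weak_gradient \<Omega> v + w \<bullet> v\<bar> \<le> 0 + \<epsilon>" .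
  qed
  then show ?thesis by linarith
qed


section \<open>Oscillating test functions\<close>

definition laplacian :: "('a::euclidean_space \<Rightarrow> real) \<Rightarrow> 'a \<Rightarrow> real" where
  "laplacian f x = (\<Sum>e\<in>Basis. partial_deriv e (partial_deriv e f) x)"

lemma laplacian_test_function:
  assumes "\<phi> \<in> test_functions \<Omega>"
  shows "laplacian \<phi> \<in> test_functions \<Omega>"
  unfolding laplacian_def[abs_def]
  by (intro test_functions_sum partial_deriv_test_function assms finite_Basis)

lemma laplacian_has_weak_div:
  assumes "\<phi> \<in> test_functions \<Omega>"
  shows "has_weak_div \<Omega> (abs_l2 (gradient \<phi>)) (abs_l2 (laplacian \<phi>))"
  unfolding has_weak_div_def
proof
  fix \<psi> assume \<psi>: "\<psi> \<in> test_functions \<Omega>"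
  have *: "abs_l2 (partial_deriv e \<phi>) \<bullet> abs_l2 (partial_deriv e \<psi>) =
      - (abs_l2 (partial_deriv e (partial_deriv e \<phi>)) \<bullet> abs_l2 \<psi>)" if e: "e \<in> Basis" for e
    using test_function_has_weak_gradient[OF partial_deriv_test_function[OF assms e]] \<psi> e
    by (simp add: has_weak_gradient_def has_weak_partial_def
        l2_component_gradient[OF partial_deriv_test_function[OF assms e] e])
  have "abs_l2 (laplacian \<phi>) = (\<Sum>e\<in>Basis. abs_l2 (partial_deriv e (partial_deriv e \<phi>)))"
    unfolding laplacian_def[abs_def]
    by (intro abs_l2_sum test_function_sq_integrable[OF partial_deriv_test_function[OF partial_deriv_test_function[OF assms]]])
  then show "abs_l2 (gradient \<phi>) \<bullet> abs_l2 (gradient \<psi>) = - (abs_l2 (laplacian \<phi>) \<bullet> abs_l2 \<psi>)"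
    by (subst inner_l2_components)
      (simp add: l2_component_gradient[OF assms] l2_component_gradient[OF \<psi>] * inner_sum_left sum_negf)
qed

lemma test_function_mem_H2:
  assumes "open \<Omega>" "\<phi> \<in> test_functions \<Omega>"
  shows "abs_l2 \<phi> \<in> H2 \<Omega>"
  using assms
  by (auto simp: H2_def test_function_mem_H1 weak_gradient_test_function l2_component_gradient
      intro: test_function_mem_H1 partial_deriv_test_function)

lemma weak_laplacian_test_function:
  assumes "open \<Omega>" "\<phi> \<in> test_functions \<Omega>"
  shows "weak_laplacian \<Omega> (abs_l2 \<phi>) = abs_l2 (laplacian \<phi>)"
  unfolding weak_laplacian_def weak_gradient_test_function[OF assms]
  by (rule weak_div_eqI[OF assms(1) test_function_mem_L2[OF laplacian_test_function[OF assms(2)]]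
        laplacian_has_weak_div[OF assms(2)]])

text \<open>
  Every square integrable function loses the same factor under rescaling, so that factor cancels
  when the gradient and the Laplacian of a rescaled function are compared.
\<close>

lemma sq_integrable_rescale:
  fixes f :: "'a::euclidean_space \<Rightarrow> 'b::euclidean_space"
  assumes f: "sq_integrable f" and r: "0 < r"
  shows "sq_integrable (\<lambda>x. f (r *\<^sub>R (x - p)))"
    and "norm (abs_l2 (\<lambda>x. f (r *\<^sub>R (x - p)))) = norm (abs_l2 f) / sqrt (r ^ DIM('a))"
proof -
  let ?g = "\<lambda>x. f (r *\<^sub>R (x - p))" and ?T = "\<lambda>x. r *\<^sub>R (x - p)"
  have [measurable]: "f \<in> borel_measurable borel" and fi: "integrable lborel (\<lambda>x. (norm (f x))\<^sup>2)"
    using f by (auto simp: sq_integrable_def)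
  have T: "(\<lambda>x. - (r *\<^sub>R p) + r *\<^sub>R x) = ?T" by (auto simp: algebra_simps)
  have lb: "lborel = density (distr lborel borel ?T) (\<lambda>_. ennreal (r ^ DIM('a)))"
    using lborel_affine[of r "- (r *\<^sub>R p)", unfolded T] r by simp
  have "integrable lborel (\<lambda>x. r ^ DIM('a) *\<^sub>R (norm (?g x))\<^sup>2)"
    using fi r by (subst (asm) lb) (simp add: integrable_density integrable_distr_eq)
  then have gi: "integrable lborel (\<lambda>x. (norm (?g x))\<^sup>2)"
    using r by simp
  show g: "sq_integrable ?g"
    using gi by (simp add: sq_integrable_def)
  have "(\<integral>x. (norm (f x))\<^sup>2 \<partial>lborel) = r ^ DIM('a) * (\<integral>x. (norm (?g x))\<^sup>2 \<partial>lborel)"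
    using r by (subst lb) (simp add: integral_density integral_distr)
  then have "(norm (abs_l2 f))\<^sup>2 = r ^ DIM('a) * (norm (abs_l2 ?g))\<^sup>2"
    using f g by (simp add: power2_norm_eq_inner inner_abs_l2)
  then have "norm (abs_l2 f) = sqrt (r ^ DIM('a)) * norm (abs_l2 ?g)"
    using r by (metis abs_norm_cancel real_sqrt_abs real_sqrt_mult)
  then show "norm (abs_l2 ?g) = norm (abs_l2 f) / sqrt (r ^ DIM('a))"
    using r by simp
qed

lemma gradient_rescale:
  assumes "\<phi> \<in> test_functions \<Omega>"
  shows "gradient (\<lambda>x. \<phi> (r *\<^sub>R (x - p))) = (\<lambda>x. r *\<^sub>R gradient \<phi> (r *\<^sub>R (x - p)))"
  by (rule ext) (simp add: gradient_def partial_deriv_rescale[OF test_function_differentiable[OF assms]]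
        scaleR_sum_right)

lemma laplacian_rescale:
  assumes "\<phi> \<in> test_functions \<Omega>"
  shows "laplacian (\<lambda>x. \<phi> (r *\<^sub>R (x - p))) = (\<lambda>x. r\<^sup>2 * laplacian \<phi> (r *\<^sub>R (x - p)))"
proof -
  have "partial_deriv e (partial_deriv e (\<lambda>x. \<phi> (r *\<^sub>R (x - p)))) =
      (\<lambda>x. r\<^sup>2 * partial_deriv e (partial_deriv e \<phi>) (r *\<^sub>R (x - p)))" if e: "e \<in> Basis" for e
  proof -
    note p = partial_deriv_test_function[OF assms e]
    have "(\<lambda>x. partial_deriv e \<phi> (r *\<^sub>R (x - p))) differentiable (at x)" for x
      using differentiable_chain_at[of "\<lambda>x. r *\<^sub>R (x - p)" x "partial_deriv e \<phi>"]
        test_function_differentiable[OF p] by (simp add: o_def)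
    then show ?thesis
      by (simp add: partial_deriv_rescale[OF test_function_differentiable[OF assms]] partial_deriv_cmult
          partial_deriv_rescale[OF test_function_differentiable[OF p]] power2_eq_square mult.assoc)
  qed
  then show ?thesis
    by (simp add: laplacian_def[abs_def] sum_distrib_left)
qed

lemma test_function_constant_if_gradient_eq_0:
  assumes \<phi>: "\<phi> \<in> test_functions \<Omega>" and 0: "abs_l2 (gradient \<phi>) = 0"
  shows "\<phi> x = \<phi> y"
proof -
  have "partial_deriv e \<phi> z = 0" if e: "e \<in> Basis" for e z
  proof -
    note p = partial_deriv_test_function[OF \<phi> e]
    have "l2_component e (abs_l2 (gradient \<phi>)) = 0"
      using l2_component_scaleR[of e 0 0] by (simp add: 0)
    then have "abs_l2 (partial_deriv e \<phi>) = abs_l2 (\<lambda>x. 0)"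
      by (simp add: l2_component_gradient[OF \<phi> e] abs_l2_zero)
    then have "AE x in lborel. x \<in> {x. partial_deriv e \<phi> x = 0}"
      by (simp add: abs_l2_eq_iff test_function_sq_integrable[OF p] sq_integrable_zero)
    then have "AE x in lebesgue. x \<in> {x. partial_deriv e \<phi> x = 0}"
      by (rule AE_completion)
    moreover have "closed {x. partial_deriv e \<phi> x = 0}"
      by (intro closed_Collect_eq test_function_continuous[OF p] continuous_on_const)
    ultimately show ?thesis
      using mem_closed_if_AE_lebesgue by blast
  qed
  note p0 = this
  have "(\<phi> has_derivative (\<lambda>_. 0)) (at z)" for z
  proof -
    have d: "(\<phi> has_derivative (\<lambda>e. partial_deriv e \<phi> z)) (at z)"
      by (rule has_derivative_partial_deriv[OF test_function_differentiable[OF \<phi>]])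
    interpret D: linear "\<lambda>e. partial_deriv e \<phi> z"
      using d has_derivative_linear by blast
    have "partial_deriv v \<phi> z = 0" for v
      using Linear_Algebra.linear_eq_stdbasis[OF D.linear_axioms linear_zero] p0 by metis
    with d show ?thesis by simp
  qed
  then have "\<exists>c. \<forall>z\<in>UNIV. \<phi> z = c"
    by (intro has_derivative_zero_constant) auto
  then show ?thesis by auto
qed

text \<open>
  Contracting a fixed bump towards a point by the factor \<open>r\<close> multiplies the ratio of the norms of
  its Laplacian and its gradient by \<open>r\<close>, and for \<open>r \<ge> 1\<close> its support stays in \<open>\<Omega>\<close>. This is where high
  frequencies enter.
\<close>

lemma exists_oscillating_test_function:
  fixes \<Omega> :: "'a::euclidean_space set"
  assumes "open \<Omega>" "\<Omega> \<noteq> {}" "0 < \<delta>"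
  obtains \<phi> where "\<phi> \<in> test_functions \<Omega>" "abs_l2 (laplacian \<phi>) \<noteq> 0"
    "norm (abs_l2 (gradient \<phi>)) \<le> \<delta> * norm (abs_l2 (laplacian \<phi>))"
proof -
  obtain p where "p \<in> \<Omega>" using assms(2) by blast
  then obtain l u where lu: "cbox l u \<subseteq> \<Omega>" "p \<in> box l u"
    using open_contains_cbox[OF assms(1)] by metis
  define f where "f = box_bump 1 (l - p) (u - p)"
  have f: "f \<in> test_functions UNIV"
    unfolding f_def by (rule box_bump_test_function) auto
  have sq: "sq_integrable (gradient f)" "sq_integrable (laplacian f)"
    using gradient_sq_integrable[OF f] test_function_sq_integrable[OF laplacian_test_function[OF f]] .
  \<comment> \<open>Testing a vanishing Laplacian of \<open>f\<close> against \<open>f\<close> itself shows that \<open>f\<close> is constant.\<close>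
  have nz: "abs_l2 (laplacian f) \<noteq> 0"
  proof
    assume "abs_l2 (laplacian f) = 0"
    with laplacian_has_weak_div[OF f] f have "abs_l2 (gradient f) \<bullet> abs_l2 (gradient f) = 0"
      by (simp add: has_weak_div_def)
    then have "abs_l2 (gradient f) = 0" by simp
    from test_function_constant_if_gradient_eq_0[OF f this] have "f 0 = f (u - p)" .
    moreover have "0 < f 0"
      using lu(2) by (simp add: f_def box_bump_pos_iff mem_box inner_diff_left)
    moreover have "\<not> 0 < f (u - p)"
      by (simp add: f_def box_bump_pos_iff mem_box)
    ultimately show False by simp
  qed
  define r where "r = max 1 (norm (abs_l2 (gradient f)) / (\<delta> * norm (abs_l2 (laplacian f))))"
  have r: "1 \<le> r" "0 < r" by (auto simp: r_def)
  define k where "k = sqrt (r ^ DIM('a))"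
  have k: "0 < k" using r by (simp add: k_def)
  let ?\<phi> = "\<lambda>x. f (r *\<^sub>R (x - p))"
  have "{x. ?\<phi> x \<noteq> 0} \<subseteq> cbox l u"
  proof
    fix x assume "x \<in> {x. ?\<phi> x \<noteq> 0}"
    then have "0 < f (r *\<^sub>R (x - p))"
      using box_bump_bounds(1)[of 1 "l - p" "u - p" "r *\<^sub>R (x - p)"] by (simp add: f_def less_le)
    then have b: "r *\<^sub>R (x - p) \<in> box (l - p) (u - p)" by (simp add: f_def box_bump_pos_iff)
    show "x \<in> cbox l u"
      unfolding mem_box
    proof
      fix e :: 'a assume e: "e \<in> Basis"
      define s where "s = x \<bullet> e - p \<bullet> e"
      have 1: "l \<bullet> e - p \<bullet> e < 0" "0 < u \<bullet> e - p \<bullet> e" "l \<bullet> e - p \<bullet> e < r * s" "r * s < u \<bullet> e - p \<bullet> e"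
        using b lu(2) e by (auto simp: mem_box inner_diff_left s_def)
      have "0 \<le> s \<Longrightarrow> s \<le> r * s" "s \<le> 0 \<Longrightarrow> r * s \<le> s"
        using mult_right_mono[OF r(1), of s] mult_right_mono_neg[OF r(1), of s] by simp_all
      then have "l \<bullet> e - p \<bullet> e \<le> s \<and> s \<le> u \<bullet> e - p \<bullet> e"
        using 1 by linarith
      then show "l \<bullet> e \<le> x \<bullet> e \<and> x \<bullet> e \<le> u \<bullet> e" by (simp add: s_def)
    qed
  qed
  then have \<phi>: "?\<phi> \<in> test_functions \<Omega>"
    by (rule test_functions_supportI[OF C_k_rescale[OF test_function_C_k[OF f]] compact_cbox lu(1)])
  have "abs_l2 (gradient ?\<phi>) = r *\<^sub>R abs_l2 (\<lambda>x. gradient f (r *\<^sub>R (x - p)))"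
    using sq_integrable_rescale(1)[OF sq(1) r(2)] by (simp add: gradient_rescale[OF f] abs_l2_scaleR)
  then have ng: "norm (abs_l2 (gradient ?\<phi>)) = r * norm (abs_l2 (gradient f)) / k"
    using sq_integrable_rescale(2)[OF sq(1) r(2)] r by (simp add: k_def)
  have "abs_l2 (laplacian ?\<phi>) = r\<^sup>2 *\<^sub>R abs_l2 (\<lambda>x. laplacian f (r *\<^sub>R (x - p)))"
    using abs_l2_scaleR[OF sq_integrable_rescale(1)[OF sq(2) r(2)], of "r\<^sup>2"]
    by (simp add: laplacian_rescale[OF f])
  then have nl: "norm (abs_l2 (laplacian ?\<phi>)) = r * (r * norm (abs_l2 (laplacian f))) / k"
    using sq_integrable_rescale(2)[OF sq(2) r(2)] r by (simp add: k_def power2_eq_square)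
  show thesis
  proof
    show "abs_l2 (laplacian ?\<phi>) \<noteq> 0"
      using nl nz r k by (metis divide_eq_0_iff less_irrefl mult_eq_0_iff norm_eq_zero)
    have "norm (abs_l2 (gradient f)) / (\<delta> * norm (abs_l2 (laplacian f))) \<le> r"
      by (simp add: r_def)
    then have "norm (abs_l2 (gradient f)) \<le> \<delta> * (r * norm (abs_l2 (laplacian f)))"
      using assms(3) nz by (simp add: field_simps)
    then have "r * norm (abs_l2 (gradient f)) / k \<le> r * (\<delta> * (r * norm (abs_l2 (laplacian f)))) / k"
      using r k by (intro divide_right_mono mult_left_mono) auto
    then show "norm (abs_l2 (gradient ?\<phi>)) \<le> \<delta> * norm (abs_l2 (laplacian ?\<phi>))"
      unfolding ng nl by (simp add: mult_ac)
  qed (rule \<phi>)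
qed


section \<open>Quadratic forms along contraction semigroups\<close>

text \<open>
  The norm \<open>N\<close> is given only on a carrier inside a vector space that has no norm of its own. The
  map \<open>J\<close> realises \<open>N\<close> as the norm of an inner product space, so that quadratic forms and the
  Cauchy--Schwarz inequality are at hand. The kernel of \<open>J\<close> on the carrier consists of the elements of
  norm 0, so limits in \<open>N\<close>, and with them the values of the generator, are determined up to this
  kernel.
\<close>

locale generated_contraction_semigroup =
  fixes H :: "'h::real_vector set" and N :: "'h \<Rightarrow> real" and S :: "real \<Rightarrow> 'h \<Rightarrow> 'h"
    and D :: "'h set" and A :: "'h \<Rightarrow> 'h" and J :: "'h \<Rightarrow> 'k::real_inner"
  assumes subspace: "subspace H"
    and J_add: "\<And>U V. U \<in> H \<Longrightarrow> V \<in> H \<Longrightarrow> J (U + V) = J U + J V"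
    and J_scaleR: "\<And>U r. U \<in> H \<Longrightarrow> J (r *\<^sub>R U) = r *\<^sub>R J U"
    and N_eq: "\<And>U. U \<in> H \<Longrightarrow> N U = norm (J U)"
    and semigroup: "contraction_C0_semigroup H N S"
    and generator: "is_generator H N S D A"
begin

lemmas H_diff = subspace_diff[OF subspace]
  and H_scaleR = subspace_scale[OF subspace]

lemma J_diff:
  assumes "U \<in> H" "V \<in> H"
  shows "J (U - V) = J U - J V"
  using J_add[OF assms(1) H_scaleR[OF assms(2)], of "-1"] J_scaleR[OF assms(2), of "-1"] by simp

lemma
  assumes "0 \<le> t" "U \<in> H"
  shows S_mem: "S t U \<in> H"
    and S_add: "V \<in> H \<Longrightarrow> S t (U + V) = S t U + S t V"
    and S_scaleR: "S t (r *\<^sub>R U) = r *\<^sub>R S t U"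
    and S_contraction: "N (S t U) \<le> N U"
    and S_compose: "0 \<le> s \<Longrightarrow> S (s + t) U = S s (S t U)"
  using semigroup assms unfolding contraction_C0_semigroup_def by blast+

lemma S_zero: "U \<in> H \<Longrightarrow> S 0 U = U"
  using semigroup unfolding contraction_C0_semigroup_def by blast

lemma S_diff:
  assumes "0 \<le> t" "U \<in> H" "V \<in> H"
  shows "S t (U - V) = S t U - S t V"
  using S_add[OF assms(1,2) H_scaleR[OF assms(3)], of "-1"] S_scaleR[OF assms(1,3), of "-1"] by simp

lemma
  assumes "U \<in> D"
  shows D_mem: "U \<in> H" and A_mem: "A U \<in> H" and A_value: "has_generator_value N S U (A U)"
  using generator assms unfolding is_generator_def by auto

text \<open>
  The difference quotients at \<open>S t U\<close> are images under \<open>S t\<close> of those at \<open>U\<close>, so by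
  contractivity they converge at a rate that does not depend on \<open>t\<close>.
\<close>

lemma difference_quotient_bound:
  assumes "U \<in> D" "0 \<le> t" "0 < h"
  shows "N ((1 / h) *\<^sub>R (S h (S t U) - S t U) - S t (A U)) \<le> N ((1 / h) *\<^sub>R (S h U - U) - A U)"
proof -
  note U = D_mem[OF assms(1)] and A = A_mem[OF assms(1)]
  have SU: "S h U \<in> H" using S_mem U assms(3) by simp
  have "S h (S t U) = S t (S h U)"
    using S_compose[of t U h] S_compose[of h U t] U assms by (simp add: add.commute)
  then have "(1 / h) *\<^sub>R (S h (S t U) - S t U) - S t (A U) = S t ((1 / h) *\<^sub>R (S h U - U) - A U)"
    using assms(2) U A SU by (simp add: S_diff S_scaleR H_diff H_scaleR)
  then show ?thesis
    using S_contraction[OF assms(2)] U A SU by (simp add: H_diff H_scaleR)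
qed

lemma generator_value_orbit:
  assumes "U \<in> D" "0 \<le> t"
  shows "has_generator_value N S (S t U) (S t (A U))"
  unfolding has_generator_value_def
proof (rule tendsto_sandwich[OF _ _ tendsto_const])
  show "((\<lambda>h. N ((1 / h) *\<^sub>R (S h U - U) - A U)) \<longlongrightarrow> 0) (at_right 0)"
    using A_value[OF assms(1)] by (simp add: has_generator_value_def)
  show "\<forall>\<^sub>F h in at_right 0. N ((1 / h) *\<^sub>R (S h (S t U) - S t U) - S t (A U))
      \<le> N ((1 / h) *\<^sub>R (S h U - U) - A U)"
    using difference_quotient_bound[OF assms] by (auto simp: eventually_at_filter)
  show "\<forall>\<^sub>F h in at_right 0. 0 \<le> N ((1 / h) *\<^sub>R (S h (S t U) - S t U) - S t (A U))"
    unfolding eventually_at_filter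
  proof (intro always_eventually allI impI)
    fix h :: real assume "h \<in> {0<..}"
    then have "(1 / h) *\<^sub>R (S h (S t U) - S t U) - S t (A U) \<in> H"
      using assms D_mem A_mem by (simp add: H_diff H_scaleR S_mem)
    then show "0 \<le> N ((1 / h) *\<^sub>R (S h (S t U) - S t U) - S t (A U))"
      by (simp add: N_eq)
  qed
qed

lemma generator_value_unique:
  assumes U: "U \<in> H" and "V \<in> H" "V' \<in> H" "has_generator_value N S U V" "has_generator_value N S U V'"
  shows "J V = J V'"
proof -
  let ?q = "\<lambda>h. (1 / h) *\<^sub>R (S h U - U)"
  have "((\<lambda>h. N (?q h - V) + N (?q h - V')) \<longlongrightarrow> 0 + 0) (at_right 0)"
    using assms(4,5) unfolding has_generator_value_def by (rule tendsto_add)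
  moreover have "\<forall>\<^sub>F h in at_right 0. norm (J V - J V') \<le> N (?q h - V) + N (?q h - V')"
    unfolding eventually_at_filter
  proof (intro always_eventually allI impI)
    fix h :: real assume "h \<in> {0<..}"
    then have q: "?q h \<in> H" using U by (simp add: H_diff H_scaleR S_mem)
    have "norm (J V - J V') = norm ((J (?q h) - J V') - (J (?q h) - J V))" by simp
    also have "\<dots> \<le> norm (J (?q h) - J V') + norm (J (?q h) - J V)" by (rule norm_triangle_ineq4)
    finally show "norm (J V - J V') \<le> N (?q h - V) + N (?q h - V')"
      using q assms(2,3) by (simp add: N_eq H_diff J_diff)
  qed
  ultimately have "norm (J V - J V') \<le> 0 + 0"
    by (intro tendsto_le[OF _ _ tendsto_const]) auto
  then show ?thesis by simp
qed

lemma
  assumes "U \<in> D" "0 \<le> t"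
  shows D_invariant: "S t U \<in> D" and J_A_orbit: "J (A (S t U)) = J (S t (A U))"
proof -
  have m: "S t U \<in> H" "S t (A U) \<in> H"
    using S_mem[OF assms(2)] D_mem A_mem assms(1) by auto
  show d: "S t U \<in> D"
    using generator generator_value_orbit[OF assms] m unfolding is_generator_def by blast
  show "J (A (S t U)) = J (S t (A U))"
    by (rule generator_value_unique[OF m(1) A_mem[OF d] m(2) A_value[OF d] generator_value_orbit[OF assms]])
qed

text \<open>
  Twice the expression bounded in \<open>K\<close> is the derivative of \<open>J (S t U) \<bullet> R (J (S t U))\<close> in \<open>t\<close>,
  because \<open>R\<close> is symmetric. The bound is obtained by summing over the steps of an
  equidistant subdivision of \<open>{0..T}\<close>, the errors being uniform in \<open>t\<close>.
\<close>

lemma quadratic_form_lower_bound: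
  assumes R: "linear R" "\<And>x y. x \<bullet> R y = R x \<bullet> y" "\<And>x. norm (R x) \<le> norm x"
    and U: "U \<in> D" and T: "0 < T"
    and K: "\<And>t. 0 \<le> t \<Longrightarrow> - K \<le> J (S t U) \<bullet> R (J (A (S t U)))"
  shows "J U \<bullet> R (J U) - 2 * K * T \<le> J (S T U) \<bullet> R (J (S T U))"
proof -
  define q where "q t = J (S t U) \<bullet> R (J (S t U))" for t
  define \<eta> where "\<eta> h = N ((1 / h) *\<^sub>R (S h U - U) - A U)" for h
  define err where "err h = 2 * N U * \<eta> h + h * (N (A U) + \<eta> h)\<^sup>2" for h
  note UH = D_mem[OF U] and AH = A_mem[OF U]
  have CS: "\<bar>x \<bullet> R y\<bar> \<le> norm x * norm y" for x y :: 'k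
  proof -
    have "\<bar>x \<bullet> R y\<bar> \<le> norm x * norm (R y)" by (rule Cauchy_Schwarz_ineq2)
    also have "\<dots> \<le> norm x * norm y" by (intro mult_left_mono R(3)) auto
    finally show ?thesis .
  qed
  \<comment> \<open>One step: expand \<open>q\<close> at \<open>V + h X\<close>, where \<open>X\<close> is the difference quotient at \<open>V\<close>.\<close>
  have step: "q t - h * (2 * K + err h) \<le> q (t + h)" if "0 \<le> t" "0 < h" for t h
  proof -
    define V where "V = S t U"
    define X where "X = (1 / h) *\<^sub>R (S h V - V)"
    have V: "V \<in> H" using S_mem[OF that(1) UH] by (simp add: V_def)
    have SV: "S h V \<in> H" using S_mem V that by simp
    have X: "X \<in> H" using V SV by (simp add: X_def H_diff H_scaleR)
    have StA: "S t (A U) \<in> H" using S_mem that AH by simp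
    have "norm (J X - J (S t (A U))) = N (X - S t (A U))"
      using X StA by (simp add: N_eq H_diff J_diff)
    also have "\<dots> \<le> \<eta> h"
      using difference_quotient_bound[OF U that] by (simp add: \<eta>_def X_def V_def)
    finally have e: "norm (J X - J (A V)) \<le> \<eta> h"
      using J_A_orbit[OF U that(1)] by (simp add: V_def)
    have "norm (J (A V)) = N (S t (A U))"
      using J_A_orbit[OF U that(1)] StA by (simp add: V_def N_eq)
    then have nA: "norm (J (A V)) \<le> N (A U)" using S_contraction[OF that(1) AH] by simp
    have nV: "norm (J V) \<le> N U"
      using S_contraction[OF that(1) UH] V by (simp add: V_def N_eq)
    have nX: "norm (J X) \<le> N (A U) + \<eta> h"
      using norm_triangle_sub[of "J X" "J (A V)"] e nA by linarith
    have "S (t + h) U = S h V"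
      using S_compose[of t U h] UH that by (simp add: V_def add.commute)
    moreover have "S h V = V + h *\<^sub>R X" using that by (simp add: X_def)
    ultimately have "J (S (t + h) U) = J V + h *\<^sub>R J X"
      using V X by (simp add: J_add J_scaleR H_scaleR)
    then have "q (t + h) = q t + 2 * h * (J V \<bullet> R (J X)) + h * h * (J X \<bullet> R (J X))"
      using R(2)[of "J X" "J V"] inner_commute[of "R (J X)" "J V"]
      by (simp add: q_def V_def linear_add[OF R(1)] linear_scale[OF R(1)] inner_add_left inner_add_right
          algebra_simps)
    moreover have "- K - N U * \<eta> h \<le> J V \<bullet> R (J X)"
    proof -
      have "J V \<bullet> R (J X) = J V \<bullet> R (J (A V)) + J V \<bullet> R (J X - J (A V))"
        by (simp add: linear_diff[OF R(1)] inner_diff_right)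
      moreover have "- K \<le> J V \<bullet> R (J (A V))" using K[OF that(1)] by (simp add: V_def)
      moreover have "norm (J V) * norm (J X - J (A V)) \<le> N U * \<eta> h"
        using nV e by (intro mult_mono) (auto intro: order_trans[OF norm_ge_zero nV])
      ultimately show ?thesis using CS[of "J V" "J X - J (A V)"] by linarith
    qed
    then have "2 * h * (- K - N U * \<eta> h) \<le> 2 * h * (J V \<bullet> R (J X))"
      using that by (intro mult_left_mono) auto
    moreover have "norm (J X) * norm (J X) \<le> (N (A U) + \<eta> h)\<^sup>2"
      using nX by (simp add: power2_eq_square mult_mono')
    then have "h * h * (- (N (A U) + \<eta> h)\<^sup>2) \<le> h * h * (J X \<bullet> R (J X))"
      using CS[of "J X" "J X"] that by (intro mult_left_mono) auto
    moreover have "2 * h * (- K - N U * \<eta> h) + h * h * (- (N (A U) + \<eta> h)\<^sup>2) = - (h * (2 * K + err h))"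
      by (simp add: err_def algebra_simps)
    ultimately show ?thesis by linarith
  qed
  have "q 0 - T * (2 * K + err (T / real (Suc n))) \<le> q T" for n
  proof -
    let ?h = "T / real (Suc n)"
    have "q 0 - real k * (?h * (2 * K + err ?h)) \<le> q (real k * ?h)" for k
    proof (induction k)
      case (Suc k)
      have "q (real k * ?h) - ?h * (2 * K + err ?h) \<le> q (real k * ?h + ?h)"
        using T by (intro step) auto
      with Suc have "q 0 - (real k * (?h * (2 * K + err ?h)) + ?h * (2 * K + err ?h)) \<le> q (real k * ?h + ?h)"
        by linarith
      moreover have "real (Suc k) * x = real k * x + x" for x by (simp add: algebra_simps)
      ultimately show ?case by presburger
    qed simp
    moreover have T': "real (Suc n) * ?h = T" by (simp del: of_nat_Suc)
    moreover have "real (Suc n) * (?h * x) = T * x" for x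
      using T' by (simp only: mult.assoc[symmetric])
    ultimately show ?thesis by metis
  qed
  moreover have "(\<lambda>n. q 0 - T * (2 * K + err (T / real (Suc n)))) \<longlonglongrightarrow> q 0 - T * (2 * K + (2 * N U * 0 + 0 * (N (A U) + 0)\<^sup>2))"
  proof -
    have h: "(\<lambda>n. T / real (Suc n)) \<longlonglongrightarrow> 0"
      using tendsto_mult[OF tendsto_const[of T] LIMSEQ_Suc[OF lim_1_over_n]] by simp
    then have "filterlim (\<lambda>n. T / real (Suc n)) (at_right 0) sequentially"
      using T by (auto simp: filterlim_at)
    moreover have "(\<eta> \<longlongrightarrow> 0) (at_right 0)"
      using A_value[OF U] by (simp add: has_generator_value_def \<eta>_def[abs_def])
    ultimately have "(\<lambda>n. \<eta> (T / real (Suc n))) \<longlonglongrightarrow> 0"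
      by (rule filterlim_compose[rotated])
    then show ?thesis
      unfolding err_def using h by (intro tendsto_intros)
  qed
  ultimately have "q 0 - T * (2 * K + (2 * N U * 0 + 0 * (N (A U) + 0)\<^sup>2)) \<le> q T"
    by (intro LIMSEQ_le_const2) auto
  then show ?thesis
    by (simp add: q_def S_zero[OF UH] algebra_simps)
qed

end


section \<open>The energy space\<close>

text \<open>The pairs \<open>(u, v)\<close> and \<open>(y, z)\<close> are kept apart because their energies get opposite signs below.\<close>

definition energy_embedding :: "real \<Rightarrow> 'a::euclidean_space set \<Rightarrow> 'a state \<Rightarrow>
    (('a, 'a) l2 \<times> ('a, real) l2) \<times> (('a, 'a) l2 \<times> ('a, real) l2)" where
  "energy_embedding a \<Omega> = (\<lambda>(u, v, y, z).
    ((sqrt a *\<^sub>R weak_gradient \<Omega> u, v), (weak_gradient \<Omega> y, z)))"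

lemma energy_norm_embedding:
  assumes "0 \<le> a"
  shows "energy_norm a \<Omega> U = norm (energy_embedding a \<Omega> U)"
  using assms
  by (cases U) (simp add: energy_norm_def energy_embedding_def norm_Pair power_mult_distrib)

lemma H1_0_zero: "open \<Omega> \<Longrightarrow> 0 \<in> H1_0 \<Omega>"
  using test_function_mem_H1_0[OF _ test_functions_zero] by (simp add: abs_l2_zero)

lemma weak_gradient_zero: "open \<Omega> \<Longrightarrow> weak_gradient \<Omega> 0 = 0"
  using H1_scaleR(2)[of \<Omega> 0 0] H1_0_subset_H1[OF H1_0_zero, of \<Omega>] by simp

lemma subspace_energy_space: "open \<Omega> \<Longrightarrow> subspace (energy_space \<Omega>)"
  by (auto simp: subspace_def energy_space_def zero_prod_def L2_zero H1_0_zero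
      intro: H1_0_add L2_add H1_0_scaleR L2_scaleR)

lemma energy_embedding_linear:
  assumes "open \<Omega>" "U \<in> energy_space \<Omega>"
  shows "V \<in> energy_space \<Omega> \<Longrightarrow>
      energy_embedding a \<Omega> (U + V) = energy_embedding a \<Omega> U + energy_embedding a \<Omega> V"
    and "energy_embedding a \<Omega> (r *\<^sub>R U) = r *\<^sub>R energy_embedding a \<Omega> U"
  using assms
  by (auto simp: energy_space_def energy_embedding_def H1_0_subset_H1 H1_add(2) H1_scaleR(2)
      scaleR_add_right)

definition reflect_first :: "'a::real_vector \<times> 'b \<Rightarrow> 'a \<times> 'b" where
  "reflect_first = (\<lambda>(p, q). (- p, q))"

lemma reflect_first_facts:
  fixes x y :: "'a::real_inner \<times> 'b::real_inner"
  shows "linear (reflect_first :: 'a \<times> 'b \<Rightarrow> _)"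
    and "x \<bullet> reflect_first y = reflect_first x \<bullet> y"
    and "norm (reflect_first x) \<le> norm x"
  by (cases x; cases y; auto intro!: linearI simp: reflect_first_def norm_Pair split_beta)+

text \<open>
  Half the rate of change of \<open>q = E(y, z) - E(u, v)\<close> along a solution, with
  \<open>E(u, v) = a |\<nabla>u|\<^sup>2 + |v|\<^sup>2\<close> and \<open>E(y, z) = |\<nabla>y|\<^sup>2 + |z|\<^sup>2\<close>. Subtracting the energy of the damped
  component turns the dissipation into a positive term, which can absorb the gradient of \<open>v\<close>
  in an estimate of the coupling term \<open>2 c (z \<bullet> v)\<close>.
\<close>

lemma system_energy_balance:
  assumes "open \<Omega>" "0 \<le> a" "(u, v, y, z) \<in> system_domain a b \<Omega>"
  shows "energy_embedding a \<Omega> (u, v, y, z) \<bullet>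
      reflect_first (energy_embedding a \<Omega> (system_operator a b c \<Omega> (u, v, y, z))) =
    b * (norm (weak_gradient \<Omega> v))\<^sup>2 + 2 * c * (z \<bullet> v)"
proof -
  let ?F = "a *\<^sub>R weak_gradient \<Omega> u + b *\<^sub>R weak_gradient \<Omega> v"
  have d: "\<exists>w\<in>L2 \<Omega>. has_weak_div \<Omega> ?F w" "v \<in> H1_0 \<Omega>" "z \<in> H1_0 \<Omega>" "y \<in> H2 \<Omega>"
    using assms(3) by (auto simp: system_domain_def)
  have 1: "weak_div \<Omega> ?F \<bullet> v = - (?F \<bullet> weak_gradient \<Omega> v)"
    using Green_formula[OF weak_div(2)[OF assms(1) d(1)] d(2)] by simp
  have 2: "weak_laplacian \<Omega> y \<bullet> z = - (weak_gradient \<Omega> y \<bullet> weak_gradient \<Omega> z)"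
    using Green_formula[OF weak_laplacian(2)[OF assms(1) d(4)] d(3)] by simp
  have 3: "sqrt a * (sqrt a * r) = a * r" for r
    using assms(2) by (simp add: mult.assoc[symmetric])
  have "energy_embedding a \<Omega> (u, v, y, z) \<bullet>
      reflect_first (energy_embedding a \<Omega> (system_operator a b c \<Omega> (u, v, y, z))) =
    - (a * (weak_gradient \<Omega> u \<bullet> weak_gradient \<Omega> v)) - weak_div \<Omega> ?F \<bullet> v + c * (z \<bullet> v)
      + weak_gradient \<Omega> y \<bullet> weak_gradient \<Omega> z + weak_laplacian \<Omega> y \<bullet> z + c * (z \<bullet> v)"
    by (simp add: energy_embedding_def system_operator_def reflect_first_def inner_add_right
        inner_diff_right 3 inner_commute[of v] inner_commute[of z "weak_laplacian \<Omega> y"])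
  then show ?thesis
    unfolding 1 2 by (simp add: inner_add_left power2_norm_eq_inner)
qed

text \<open>
  If \<open>V\<close> agrees in the energy norm with the image of \<open>W = (u', v', y', z')\<close> under the operator, then \<open>z = \<Delta>y' + c v'\<close>, and
  integration by parts gives \<open>z \<bullet> v = - \<nabla>y' \<bullet> \<nabla>v + c (v' \<bullet> v)\<close>. The coupling is thus controlled
  by the small quantity \<open>\<omega>\<close>, apart from a factor \<open>|\<nabla>v|\<close>, which the dissipation absorbs.
\<close>

lemma system_balance_lower_bound:
  fixes V W :: "'a::euclidean_space state"
  assumes "open \<Omega>" "0 < a" "0 < b" and V: "V \<in> system_domain a b \<Omega>" and W: "W \<in> system_domain a b \<Omega>"
    and eq: "energy_embedding a \<Omega> (system_operator a b c \<Omega> W) = energy_embedding a \<Omega> V"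
    and \<omega>: "energy_norm a \<Omega> W \<le> \<omega>" and \<rho>: "energy_norm a \<Omega> V \<le> \<rho>"
  shows "- (c\<^sup>2 / b * \<omega>\<^sup>2 + 2 * c\<^sup>2 * \<omega> * \<rho>) \<le>
    energy_embedding a \<Omega> V \<bullet> reflect_first (energy_embedding a \<Omega> (system_operator a b c \<Omega> V))"
proof -
  obtain u v y z where V': "V = (u, v, y, z)" by (cases V)
  obtain u' v' y' z' where W': "W = (u', v', y', z')" by (cases W)
  let ?g = "norm (weak_gradient \<Omega> v)" and ?p = "norm (weak_gradient \<Omega> y')"
  have v: "v \<in> H1_0 \<Omega>" using V V' by (simp add: system_domain_def)
  have y': "y' \<in> H2 \<Omega>" using W W' by (simp add: system_domain_def)
  have "z = weak_laplacian \<Omega> y' + c *\<^sub>R v'"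
    using eq by (simp add: V' W' energy_embedding_def system_operator_def)
  then have zv: "z \<bullet> v = - (weak_gradient \<Omega> y' \<bullet> weak_gradient \<Omega> v) + c * (v' \<bullet> v)"
    using Green_formula[OF weak_laplacian(2)[OF assms(1) y'] v] by (simp add: inner_add_left)
  have comp: "norm r \<le> energy_norm a \<Omega> (s, r, t, q)" "norm (weak_gradient \<Omega> t) \<le> energy_norm a \<Omega> (s, r, t, q)"
    for s r t q
    using assms(2) by (auto simp: energy_norm_def intro!: real_le_rsqrt add_nonneg_nonneg)
  have v'\<omega>: "norm v' \<le> \<omega>" and p\<omega>: "?p \<le> \<omega>" and v\<rho>: "norm v \<le> \<rho>"
    using comp[where r = v' and t = y'] comp[where r = v] \<omega> \<rho> unfolding V' W' by (meson order_trans)+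
  have 1: "\<bar>c * (weak_gradient \<Omega> y' \<bullet> weak_gradient \<Omega> v)\<bar> \<le> \<bar>c\<bar> * (?p * ?g)"
    unfolding abs_mult by (intro mult_left_mono Cauchy_Schwarz_ineq2) auto
  have "\<bar>v' \<bullet> v\<bar> \<le> norm v' * norm v" by (rule Cauchy_Schwarz_ineq2)
  also have "\<dots> \<le> \<omega> * \<rho>" using v'\<omega> v\<rho> by (intro mult_mono) (auto intro: order_trans[OF norm_ge_zero])
  finally have "c\<^sup>2 * \<bar>v' \<bullet> v\<bar> \<le> c\<^sup>2 * (\<omega> * \<rho>)" by (intro mult_left_mono) auto
  moreover have "c\<^sup>2 * - \<bar>v' \<bullet> v\<bar> \<le> c\<^sup>2 * (v' \<bullet> v)" by (intro mult_left_mono) auto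
  ultimately have 2: "- (c\<^sup>2 * (\<omega> * \<rho>)) \<le> c\<^sup>2 * (v' \<bullet> v)" by simp
  \<comment> \<open>Complete the square in the norm of the gradient of \<open>v\<close>.\<close>
  have "0 \<le> (b * ?g - \<bar>c\<bar> * ?p)\<^sup>2 / b" using assms(3) by simp
  also have "\<dots> = b * ?g\<^sup>2 - 2 * (\<bar>c\<bar> * (?p * ?g)) + c\<^sup>2 / b * ?p\<^sup>2"
    using assms(3) by (simp add: power2_diff power_mult_distrib field_simps power2_eq_square[of b])
  finally have 3: "0 \<le> b * ?g\<^sup>2 - 2 * (\<bar>c\<bar> * (?p * ?g)) + c\<^sup>2 / b * ?p\<^sup>2" .
  have 4: "c\<^sup>2 / b * ?p\<^sup>2 \<le> c\<^sup>2 / b * \<omega>\<^sup>2"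
    using assms(3) p\<omega> by (intro mult_left_mono power_mono) auto
  have "b * ?g\<^sup>2 + 2 * c * (z \<bullet> v) =
      b * ?g\<^sup>2 - 2 * (c * (weak_gradient \<Omega> y' \<bullet> weak_gradient \<Omega> v)) + 2 * (c\<^sup>2 * (v' \<bullet> v))"
    by (simp add: zv algebra_simps power2_eq_square)
  then have "- (c\<^sup>2 / b * \<omega>\<^sup>2 + 2 * (c\<^sup>2 * (\<omega> * \<rho>))) \<le> b * ?g\<^sup>2 + 2 * c * (z \<bullet> v)"
    using 1 2 3 4 by linarith
  then show ?thesis
    using system_energy_balance[OF assms(1) _ V[unfolded V'], of c] assms(2) by (simp add: V' mult.assoc)
qed


section \<open>Absence of uniform decay\<close>

theorem theorem3p1:
  fixes \<Omega> :: "(real ^ 'n) set"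
    and a b c :: real
    and S :: "real \<Rightarrow> (real ^ 'n) state \<Rightarrow> (real ^ 'n) state"
  assumes "bounded \<Omega>" and "open \<Omega>" and "\<Omega> \<noteq> {}" and "lipschitz_boundary \<Omega>"
    and "a > 0" and "b > 0" and "c \<noteq> 0"
    and "contraction_C0_semigroup (energy_space \<Omega>) (energy_norm a \<Omega>) S"
    and "is_generator (energy_space \<Omega>) (energy_norm a \<Omega>) S
           (system_domain a b \<Omega>) (system_operator a b c \<Omega>)"
  shows "\<not> (\<exists>M>0. \<exists>\<epsilon>>0. \<forall>t>0. \<forall>U\<^sub>0\<in>energy_space \<Omega>.
           energy_norm a \<Omega> (S t U\<^sub>0) \<le> M * exp (- \<epsilon> * t) * energy_norm a \<Omega> U\<^sub>0)"
proof
  note op = \<open>open \<Omega>\<close>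
  let ?H = "energy_space \<Omega>" and ?N = "energy_norm a \<Omega>" and ?J = "energy_embedding a \<Omega>"
  let ?D = "system_domain a b \<Omega>" and ?A = "system_operator a b c \<Omega>"
  interpret generated_contraction_semigroup ?H ?N S ?D ?A ?J
    by unfold_locales
      (use assms op in \<open>auto simp: subspace_energy_space energy_embedding_linear energy_norm_embedding\<close>)
  assume "\<exists>M>0. \<exists>\<epsilon>>0. \<forall>t>0. \<forall>U\<^sub>0\<in>?H. ?N (S t U\<^sub>0) \<le> M * exp (- \<epsilon> * t) * ?N U\<^sub>0"
  then obtain M \<epsilon> where M: "M > 0" and \<epsilon>: "\<epsilon> > 0"
      and decay: "\<And>t U\<^sub>0. t > 0 \<Longrightarrow> U\<^sub>0 \<in> ?H \<Longrightarrow> ?N (S t U\<^sub>0) \<le> M * exp (- \<epsilon> * t) * ?N U\<^sub>0"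
    by blast
  \<comment> \<open>By time \<open>T\<close> the assumed decay has reduced the squared norm to at most a quarter.\<close>
  define T where "T = (\<bar>ln (2 * M)\<bar> + 1) / \<epsilon>"
  have T: "T > 0" using \<epsilon> by (auto simp: T_def)
  have half: "M * exp (- \<epsilon> * T) \<le> 1 / 2"
  proof -
    have "exp (- \<epsilon> * T) \<le> exp (- ln (2 * M))" using \<epsilon> by (simp add: T_def)
    also have "\<dots> = 1 / (2 * M)" using M by (simp add: exp_minus inverse_eq_divide)
    finally show ?thesis using M by (simp add: field_simps)
  qed
  define L where "L = c\<^sup>2 / b + 2 * c\<^sup>2"
  have L: "L > 0" using assms by (simp add: L_def add_pos_pos)
  \<comment> \<open>\<open>\<delta>\<close> makes the total loss of \<open>q\<close> up to time \<open>T\<close> at most half of its initial value.\<close>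
  define \<delta> where "\<delta> = min 1 (1 / (4 * T * L))"
  have \<delta>: "0 < \<delta>" "\<delta> \<le> 1" "\<delta> * (4 * T * L) \<le> 1"
  proof -
    show "0 < \<delta>" "\<delta> \<le> 1" using T L by (auto simp: \<delta>_def)
    have "\<delta> \<le> 1 / (4 * T * L)" by (simp add: \<delta>_def)
    then show "\<delta> * (4 * T * L) \<le> 1" using T L by (simp add: field_simps)
  qed
  obtain \<phi> where \<phi>: "\<phi> \<in> test_functions \<Omega>" and nz: "abs_l2 (laplacian \<phi>) \<noteq> 0"
      and osc: "norm (abs_l2 (gradient \<phi>)) \<le> \<delta> * norm (abs_l2 (laplacian \<phi>))"
    using exists_oscillating_test_function[OF op \<open>\<Omega> \<noteq> {}\<close> \<delta>(1)] .
  define W where "W = (0 :: (real ^ 'n, real) l2, 0 :: (real ^ 'n, real) l2, abs_l2 \<phi>, 0 :: (real ^ 'n, real) l2)"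
  define U where "U = (0 :: (real ^ 'n, real) l2, 0 :: (real ^ 'n, real) l2, 0 :: (real ^ 'n, real) l2, abs_l2 (laplacian \<phi>))"
  note l\<phi> = laplacian_test_function[OF \<phi>]
  have H2_0: "0 \<in> H2 \<Omega>"
    using test_function_mem_H2[OF op test_functions_zero] by (simp add: abs_l2_zero)
  have div0: "\<exists>w\<in>L2 \<Omega>. has_weak_div \<Omega> 0 w"
    by (rule bexI[of _ 0]) (auto simp: has_weak_div_def L2_zero)
  have W: "W \<in> ?D" and U: "U \<in> ?D"
    using test_function_mem_H1_0[OF op \<phi>] test_function_mem_H2[OF op \<phi>] test_function_mem_H1_0[OF op l\<phi>]
      test_function_mem_L2[OF l\<phi>] H2_0 div0
    by (auto simp: W_def U_def system_domain_def energy_space_def H1_0_zero[OF op] L2_zero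
        weak_gradient_zero[OF op])
  have AW: "?A W = U"
    by (simp add: W_def U_def system_operator_def weak_gradient_zero[OF op] weak_div_zero[OF op]
        weak_laplacian_test_function[OF op \<phi>])
  define \<rho> where "\<rho> = norm (abs_l2 (laplacian \<phi>))"
  have \<rho>: "\<rho> > 0" using nz by (simp add: \<rho>_def)
  have NU: "?N U = \<rho>"
    by (simp add: U_def energy_norm_def weak_gradient_zero[OF op] \<rho>_def)
  have NW: "?N W \<le> \<delta> * \<rho>"
    using osc by (simp add: W_def energy_norm_def weak_gradient_zero[OF op] \<rho>_def weak_gradient_test_function[OF op \<phi>])
  let ?K = "c\<^sup>2 / b * (\<delta> * \<rho>)\<^sup>2 + 2 * c\<^sup>2 * (\<delta> * \<rho>) * \<rho>"
  have "- ?K \<le> ?J (S t U) \<bullet> reflect_first (?J (?A (S t U)))" if t: "0 \<le> t" for t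
  proof (rule system_balance_lower_bound[OF op assms(5,6) D_invariant[OF U t] D_invariant[OF W t]])
    show "?J (?A (S t W)) = ?J (S t U)"
      using J_A_orbit[OF W t] by (simp add: AW)
    show "?N (S t W) \<le> \<delta> * \<rho>"
      using S_contraction[OF t D_mem[OF W]] NW by simp
    show "?N (S t U) \<le> \<rho>"
      using S_contraction[OF t D_mem[OF U]] NU by simp
  qed
  then have low: "?J U \<bullet> reflect_first (?J U) - 2 * ?K * T \<le> ?J (S T U) \<bullet> reflect_first (?J (S T U))"
    by (intro quadratic_form_lower_bound reflect_first_facts U T)
  have "?J U \<bullet> reflect_first (?J U) = \<rho>\<^sup>2"
    by (simp add: U_def energy_embedding_def reflect_first_def weak_gradient_zero[OF op] \<rho>_def power2_norm_eq_inner)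
  moreover have "2 * ?K * T \<le> \<rho>\<^sup>2 / 2"
  proof -
    have "c\<^sup>2 / b * (\<delta>\<^sup>2 * \<rho>\<^sup>2) \<le> c\<^sup>2 / b * (\<delta> * \<rho>\<^sup>2)"
      using \<delta> assms(6) by (intro mult_left_mono mult_right_mono) (auto simp: power2_eq_square mult_left_le)
    then have "?K \<le> L * \<delta> * \<rho>\<^sup>2"
      by (simp add: L_def power_mult_distrib algebra_simps power2_eq_square[of \<rho>])
    then have "2 * ?K * T \<le> 2 * (L * \<delta> * \<rho>\<^sup>2) * T"
      using T by (intro mult_right_mono mult_left_mono) auto
    also have "\<dots> = \<delta> * (4 * T * L) * (\<rho>\<^sup>2 / 2)" by simp
    also have "\<dots> \<le> 1 * (\<rho>\<^sup>2 / 2)" by (intro mult_right_mono \<delta>(3)) auto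
    finally show ?thesis by simp
  qed
  moreover have "?J (S T U) \<bullet> reflect_first (?J (S T U)) \<le> \<rho>\<^sup>2 / 4"
  proof -
    let ?x = "?J (S T U)"
    have "?x \<bullet> reflect_first ?x \<le> norm ?x * norm (reflect_first ?x)" by (rule norm_cauchy_schwarz)
    also have "\<dots> \<le> norm ?x * norm ?x" by (intro mult_left_mono reflect_first_facts) auto
    also have "\<dots> = (?N (S T U))\<^sup>2"
      using assms(5) by (simp add: energy_norm_embedding power2_eq_square)
    also have "\<dots> \<le> (1 / 2 * \<rho>)\<^sup>2"
    proof (rule power_mono)
      have "?N (S T U) \<le> M * exp (- \<epsilon> * T) * \<rho>" using decay[OF T D_mem[OF U]] NU by simp
      also have "\<dots> \<le> 1 / 2 * \<rho>" using half \<rho> by (intro mult_right_mono) auto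
      finally show "?N (S T U) \<le> 1 / 2 * \<rho>" .
      show "0 \<le> ?N (S T U)" using assms(5) by (simp add: energy_norm_embedding)
    qed
    finally show ?thesis by (simp add: power2_eq_square)
  qed
  moreover have "0 < \<rho>\<^sup>2" using \<rho> by simp
  ultimately show False using low by linarith
qed

end
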